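(* Let $\mathfrak{G}$ be a realizable Gauss diagram with $n$ chords $\mathfrak{c}_1,\dots,\mathfrak{c}_n$, each of which is crossed by at least one other chord. Let $\mathsf{M}(\mathfrak{G})$ be its matrix, with rows $\mathsf{m}_1,\dots,\mathsf{m}_n$. Then: (1) $\langle \mathsf{m}_i,\mathsf{m}_i\rangle\equiv 0\pmod 2$ for all $1\le i\le n$; (2) $\langle \mathsf{m}_i,\mathsf{m}_j\rangle\equiv 0\pmod 2$ whenever the chords $\mathfrak{c}_i,\mathfrak{c}_j$ do not intersect; (3) $\langle \mathsf{m}_i,\mathsf{m}_j\rangle+\langle \mathsf{m}_i,\mathsf{m}_k\rangle+\langle \mathsf{m}_j,\mathsf{m}_k\rangle\equiv 1\pmod 2$ whenever the chords $\mathfrak{c}_i,\mathfrak{c}_j,\mathfrak{c}_k$ pairwise intersect.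
   Context: A Gauss diagram (chord diagram) is an oriented circle with finitely many chords whose endpoints are pairwise distinct points of the circle. Two distinct chords intersect (cross) if their endpoints alternate along the circle. The Gauss diagram of a generic immersion $S^1\to\mathbb{R}^2$ (all multiple points are transversal double points) is the circle $S^1$ with the two preimages of each double point joined by a chord. A Gauss diagram is realizable if it is the Gauss diagram of some such generic immersion $S^1\to\mathbb{R}^2$. The matrix $\mathsf{M}(\mathfrak{G})=(\mathsf{m}_{ij})_{1\le i,j\le n}$ over $\mathbb{Z}_2$ is defined by $\mathsf{m}_{ii}=0$, and for $i\ne j$, $\mathsf{m}_{ij}=1$ if $\mathfrak{c}_i$ and $\mathfrak{c}_j$ intersect and $\mathsf{m}_{ij}=0$ otherwise. Its $i$-th row is $\mathsf{m}_i=(\mathsf{m}_{i1},\dots,\mathsf{m}_{in})$, and $\langle \mathsf{m}_i,\mathsf{m}_j\rangle=\mathsf{m}_{i1}\mathsf{m}_{j1}+\cdots+\mathsf{m}_{in}\mathsf{m}_{jn}$. *)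

theory Defs
  imports "HOL-Analysis.Analysis" "HOL-Library.Z2"
begin

text \<open>
  The oriented circle is the unit circle of the complex plane, oriented by increasing
  \<open>t\<close> in the parametrization \<open>cis t\<close>. A chord is identified with its two-element set
  of endpoints, and a Gauss diagram with its set of chords.
\<close>

definition gauss_diagram :: "complex set set \<Rightarrow> bool" where
  "gauss_diagram G \<longleftrightarrow>
     finite G \<and> (\<forall>c\<in>G. c \<subseteq> sphere 0 1 \<and> card c = 2) \<and> pairwise disjnt G"

text \<open>The four endpoints occur alternately during one turn around the circle.\<close>

definition chords_cross :: "complex set \<Rightarrow> complex set \<Rightarrow> bool" where
  "chords_cross c d \<longleftrightarrow>
     (\<exists>t1 t2 t3 t4. t1 < t2 \<and> t2 < t3 \<and> t3 < t4 \<and> t4 < t1 + 2 * pi \<and>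
        c = {cis t1, cis t3} \<and> d = {cis t2, cis t4})"

text \<open>
  A map on the circle is studied through \<open>\<lambda>t. f (cis t)\<close>; since \<open>cis\<close> is a local
  diffeomorphism onto the circle, this gives the usual notions of smoothness and of
  differential. The values of \<open>f\<close> off the circle are irrelevant.
\<close>

definition smooth_curve :: "(real \<Rightarrow> 'a::real_normed_vector) \<Rightarrow> bool" where
  "smooth_curve g \<longleftrightarrow>
     (\<forall>k t. ((\<lambda>h s. vector_derivative h (at s)) ^^ k) g differentiable (at t))"

definition velocity :: "(complex \<Rightarrow> real ^ 2) \<Rightarrow> real \<Rightarrow> real ^ 2" where
  "velocity f t = vector_derivative (\<lambda>s. f (cis s)) (at t)"

definition circle_immersion :: "(complex \<Rightarrow> real ^ 2) \<Rightarrow> bool" where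
  "circle_immersion f \<longleftrightarrow>
     smooth_curve (\<lambda>t. f (cis t)) \<and> (\<forall>t. velocity f t \<noteq> 0)"

text \<open>
  No value is taken three times, and the two branches through a double point are
  transversal, that is, their tangent lines together span the plane.
\<close>

definition generic_immersion :: "(complex \<Rightarrow> real ^ 2) \<Rightarrow> bool" where
  "generic_immersion f \<longleftrightarrow>
     circle_immersion f \<and>
     (\<forall>x\<in>sphere 0 1. \<forall>y\<in>sphere 0 1. \<forall>z\<in>sphere 0 1.
        f x = f y \<and> f y = f z \<longrightarrow> x = y \<or> y = z \<or> x = z) \<and>
     (\<forall>s t. cis s \<noteq> cis t \<and> f (cis s) = f (cis t) \<longrightarrow>
        span {velocity f s, velocity f t} = UNIV)"

definition gauss_diagram_of :: "(complex \<Rightarrow> real ^ 2) \<Rightarrow> complex set set" where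
  "gauss_diagram_of f =
     {{x, y} | x y. x \<in> sphere 0 1 \<and> y \<in> sphere 0 1 \<and> x \<noteq> y \<and> f x = f y}"

text \<open>
  Orientation-preserving self-homeomorphisms of the circle, described by their lifts
  to the universal cover. Gauss diagrams are considered up to these.
\<close>

definition circle_op_homeo :: "(complex \<Rightarrow> complex) \<Rightarrow> bool" where
  "circle_op_homeo h \<longleftrightarrow>
     (\<exists>\<phi>::real \<Rightarrow> real. continuous_on UNIV \<phi> \<and> strict_mono \<phi> \<and>
        (\<forall>t. \<phi> (t + 2 * pi) = \<phi> t + 2 * pi) \<and> (\<forall>t. h (cis t) = cis (\<phi> t)))"

definition realizable :: "complex set set \<Rightarrow> bool" where
  "realizable G \<longleftrightarrow>
     (\<exists>f h. generic_immersion f \<and> circle_op_homeo h \<and>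
        G = (\<lambda>c. h ` c) ` gauss_diagram_of f)"

text \<open>
  The chords are labelled by a finite type \<open>'n\<close>, so that \<open>n = CARD('n)\<close>; the type
  \<open>bit\<close> is the field with two elements, in which congruence modulo 2 is equality.
\<close>

definition gauss_matrix :: "('n::finite \<Rightarrow> complex set) \<Rightarrow> bit ^ 'n ^ 'n" where
  "gauss_matrix c = (\<chi> i j. if i \<noteq> j \<and> chords_cross (c i) (c j) then 1 else 0)"

definition bit_dot :: "bit ^ 'n::finite \<Rightarrow> bit ^ 'n \<Rightarrow> bit" where
  "bit_dot u v = (\<Sum>k\<in>UNIV. u $ k * v $ k)"

end

(* A closed loop in the image of the immersion has a winding number around every point off it,
   and the parity of this number changes exactly when the point crosses the loop transversally.
   Hence any other closed curve that meets the loop only in transversal crossings, or touches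
   it at a corner without crossing, crosses it an even number of times. For a chord, the two loops
   into which its double point divides the curve give (1); the disjoint loops of two
   non-intersecting chords give (2). Three pairwise intersecting chords cut the circle into six
   arcs; opposite arcs join up to three loops, and the parities of their mutual crossings, added
   to (1) for the three chords, give (3). *)
theory Submission
  imports Defs "HOL-Complex_Analysis.Winding_Numbers"
begin

subsection \<open>Winding numbers across a transversal crossing\<close>

text \<open>The parity of the winding number plays the part of the intersection form modulo 2, so no
  curve has to be moved into general position. Two obstacles shape the argument. The loops have
  corners, so the jump at a crossing is computed on a single smooth arc. An open arc has
  non-integral winding numbers, and its jump is known only as a limit; it becomes an exact odd
  number once the arcs are assembled into a closed loop. Secondly, in (1) and (3) the second curve
  starts at a corner of the loop itself, where no parity is defined. Its two ends leave the corner
  into one sector of the complement, and a short segment in this sector joins them, so the parity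
  agrees at both. Every crossing counted in this way is a double point, hence a chord joining two
  families of arcs; with the circle cut open at an endpoint, counting such chords becomes a
  comparison of real numbers.\<close>

text \<open>Dividing by \<open>c\<close> turns the branch cut of \<open>Ln\<close> into the ray from
  \<open>z\<close> in the direction \<open>- c\<close>. On a path that misses this ray there is a
  continuous logarithm, whose increment measures the winding, also when the path is not
  closed.\<close>

lemma winding_number_eq_Ln:
  assumes "path \<gamma>" and "c \<noteq> 0"
    and slit: "\<And>t. t \<in> {0..1} \<Longrightarrow> (\<gamma> t - z) / c \<notin> \<real>\<^sub>\<le>\<^sub>0"
  shows "winding_number \<gamma> z = (Ln ((\<gamma> 1 - z) / c) - Ln ((\<gamma> 0 - z) / c)) / (2 * of_real pi * \<i>)"
proof -
  define p where "p = (\<lambda>t. Ln ((\<gamma> t - z) / c) + Ln c)"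
  have "continuous_on {0..1} \<gamma>"
    using assms by (simp add: path_def)
  then have "path p"
    unfolding path_def p_def by (intro continuous_intros) (use slit assms in auto)
  have "\<gamma> t - z = (exp \<circ> p) t" if "t \<in> {0..1}" for t
  proof -
    have "(\<gamma> t - z) / c \<noteq> 0"
      using slit[OF that] by auto
    then show ?thesis
      using assms by (simp add: p_def exp_add)
  qed
  then have "winding_number \<gamma> z = winding_number (exp \<circ> p) 0"
    by (subst winding_number_offset, intro winding_number_cong) auto
  then show ?thesis
    using winding_number_compose_exp[OF \<open>path p\<close>] by (simp add: p_def pathfinish_def pathstart_def)
qed

text \<open>
  Here \<open>x\<close> is a point of a curve with tangent \<open>\<omega>\<close> at \<open>0\<close>, and \<open>y\<close> lies on a transversal
  branch with tangent \<open>1\<close>. Seen from \<open>y\<close>, the curve misses the positive ray, so a logarithm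
  cut along that ray computes its winding around \<open>y\<close>; on the other side of the crossing
  the opposite ray is missed, and the two logarithms differ by \<open>\<plusminus> \<i> \<pi>\<close> at the two ends.
\<close>
lemma transversal_crossing_cone:
  fixes \<omega> :: complex and M m \<eta> :: real
  assumes "Im \<omega> \<noteq> 0" and "\<eta> > 0" "\<eta> \<le> 1/4" "\<eta> \<le> \<bar>Im \<omega>\<bar> / (8 * (cmod \<omega> + 1))"
    and e: "e > 0" and x: "cmod (x - of_real h * \<omega>) \<le> \<eta> * \<bar>h\<bar>"
    and y: "cmod (y - of_real e) \<le> \<eta> * e"
  shows "x - y \<notin> \<real>\<^sub>\<ge>\<^sub>0"
proof
  assume "x - y \<in> \<real>\<^sub>\<ge>\<^sub>0"
  then obtain r where r: "r \<ge> 0" "x - y = of_real r"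
    using nonneg_Reals_cases by blast
  have "\<bar>Im \<omega>\<bar> \<le> cmod \<omega>"
    by (rule abs_Im_le_cmod)
  have m: "0 < \<bar>Im \<omega>\<bar>" using assms by simp
  have eta: "8 * \<eta> * (cmod \<omega> + 1) \<le> \<bar>Im \<omega>\<bar>"
    using assms(4) by (simp add: pos_le_divide_eq add_nonneg_pos mult.commute mult.left_commute)
  define err where "err = (y - of_real e) - (x - of_real h * \<omega>)"
  have "cmod err \<le> \<eta> * e + \<eta> * \<bar>h\<bar>"
    unfolding err_def using norm_triangle_ineq4[of "y - of_real e" "x - of_real h * \<omega>"] x y by linarith
  then have Im_err: "\<bar>Im err\<bar> \<le> \<eta> * e + \<eta> * \<bar>h\<bar>" and Re_err: "\<bar>Re err\<bar> \<le> \<eta> * e + \<eta> * \<bar>h\<bar>"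
    using abs_Im_le_cmod[of err] abs_Re_le_cmod[of err] by linarith+
  \<comment> \<open>The imaginary part of this identity makes
    \<open>\<bar>h\<bar> * \<bar>Im \<omega>\<bar>\<close> at most \<open>2 * \<eta> * e\<close>;
    the real part makes \<open>\<bar>h\<bar> * (cmod \<omega> + 1)\<close> at least
    \<open>3/4 * e\<close>. The factor 8 in the bound on \<eta> makes the two incompatible.\<close>
  have eq: "of_real h * \<omega> = of_real (r + e) + err"
    using r by (simp add: err_def algebra_simps)
  have "h * Im \<omega> = Im err"
    using arg_cong[OF eq, of Im] by simp
  then have "\<bar>h\<bar> * \<bar>Im \<omega>\<bar> \<le> \<eta> * e + \<eta> * \<bar>h\<bar>"
    using Im_err by (simp flip: abs_mult)
  moreover have "\<eta> * 2 \<le> \<bar>Im \<omega>\<bar>"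
  proof -
    have "\<eta> * 2 * 1 \<le> \<eta> * 2 * (4 * (cmod \<omega> + 1))"
      using assms(2) by (intro mult_left_mono) auto
    then show ?thesis using eta by (simp add: algebra_simps)
  qed
  then have "\<bar>h\<bar> * (\<eta> * 2) \<le> \<bar>h\<bar> * \<bar>Im \<omega>\<bar>"
    by (intro mult_left_mono) auto
  ultimately have h: "\<bar>h\<bar> * \<bar>Im \<omega>\<bar> \<le> 2 * \<eta> * e"
    by (simp add: algebra_simps)
  have "h * Re \<omega> = r + e + Re err"
    using arg_cong[OF eq, of Re] by simp
  then have "e \<le> \<bar>h * Re \<omega>\<bar> + \<eta> * e + \<eta> * \<bar>h\<bar>"
    using Re_err r(1) by linarith
  moreover have "\<bar>h * Re \<omega>\<bar> \<le> \<bar>h\<bar> * cmod \<omega>"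
    using abs_Re_le_cmod[of \<omega>] by (simp add: abs_mult mult_left_mono)
  moreover have "\<eta> * \<bar>h\<bar> \<le> \<bar>h\<bar>" "\<eta> * e \<le> 1/4 * e"
    using assms(3) e by (auto intro: mult_left_le_one_le mult_right_mono simp: assms(2) less_imp_le)
  ultimately have "3/4 * e \<le> \<bar>h\<bar> * (cmod \<omega> + 1)"
    by (simp add: algebra_simps)
  then have "3/4 * e * \<bar>Im \<omega>\<bar> \<le> \<bar>h\<bar> * (cmod \<omega> + 1) * \<bar>Im \<omega>\<bar>"
    by (intro mult_right_mono) auto
  also have "\<dots> = (\<bar>h\<bar> * \<bar>Im \<omega>\<bar>) * (cmod \<omega> + 1)"
    by simp
  also have "\<dots> \<le> 2 * \<eta> * e * (cmod \<omega> + 1)"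
    by (intro mult_right_mono h) auto
  also have "\<dots> = e/4 * (8 * \<eta> * (cmod \<omega> + 1))"
    by simp
  also have "\<dots> \<le> e/4 * \<bar>Im \<omega>\<bar>"
    using e by (intro mult_left_mono eta) auto
  finally have "e * \<bar>Im \<omega>\<bar> \<le> 0" by simp
  then show False using e m by (simp add: mult_le_0_iff)
qed

lemma has_vector_derivative_remainder_bound:
  assumes "(f has_vector_derivative D) (at x)" and "\<eta> > 0"
  obtains d where "d > 0" "\<And>h. \<bar>h\<bar> < d \<Longrightarrow> norm (f (x + h) - f x - h *\<^sub>R D) \<le> \<eta> * \<bar>h\<bar>"
proof -
  obtain d where "d > 0"
    and d: "\<And>y. \<bar>y - x\<bar> < d \<Longrightarrow> norm (f y - f x - (y - x) *\<^sub>R D) \<le> \<eta> * \<bar>y - x\<bar>"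
    using assms unfolding has_vector_derivative_def has_derivative_at_alt real_norm_def by blast
  show thesis
  proof (rule that[OF \<open>d > 0\<close>])
    fix h :: real assume "\<bar>h\<bar> < d"
    then show "norm (f (x + h) - f x - h *\<^sub>R D) \<le> \<eta> * \<bar>h\<bar>"
      using d[of "x + h"] by simp
  qed
qed

text \<open>The two outer pieces of \<alpha> miss the crossing point, so their winding numbers are
  continuous there and cancel in the limit. The jump comes from the short middle piece, computed by
  logarithms with opposite cuts on the two sides. As \<alpha> need not be closed, the integer
  appears only in the limit.\<close>

lemma winding_number_jump:
  fixes \<alpha> \<beta> :: "real \<Rightarrow> complex"
  assumes \<alpha>: "path \<alpha>" and u0: "u0 \<in> {0<..<1}"
    and uniq: "\<And>u. u \<in> {0..1} \<Longrightarrow> \<alpha> u = \<beta> v0 \<Longrightarrow> u = u0"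
    and meet: "\<alpha> u0 = \<beta> v0"
    and d\<alpha>: "(\<alpha> has_vector_derivative w1) (at u0)"
    and d\<beta>: "(\<beta> has_vector_derivative w2) (at v0)"
    and transversal: "Im (w1 * cnj w2) \<noteq> 0"
  obtains k where "k = 1 \<or> k = -1"
    "((\<lambda>e. winding_number \<alpha> (\<beta> (v0 + e)) - winding_number \<alpha> (\<beta> (v0 - e))) \<longlongrightarrow> k) (at_right 0)"
proof -
  define p where "p = \<beta> v0"
  define \<omega> where "\<omega> = w1 / w2"
  have w2: "w2 \<noteq> 0" using transversal by auto
  have "Im \<omega> = Im (w1 * cnj w2) / (cmod w2)\<^sup>2"
    unfolding \<omega>_def by (subst complex_div_cnj) simp
  then have \<omega>: "Im \<omega> \<noteq> 0" using transversal w2 by simp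
  define \<eta> where "\<eta> = min (1/4) (\<bar>Im \<omega>\<bar> / (8 * (cmod \<omega> + 1)))"
  have \<eta>: "\<eta> > 0" "\<eta> \<le> 1/4" "\<eta> \<le> \<bar>Im \<omega>\<bar> / (8 * (cmod \<omega> + 1))"
    unfolding \<eta>_def using \<omega> by (simp_all add: add_nonneg_pos del: distrib_left_numeral)
  \<comment> \<open>Coordinates in which the crossing is at 0, \<beta> has tangent 1 and \<alpha>
    has tangent \<omega>.\<close>
  define A where "A = (\<lambda>h. (\<alpha> (u0 + h) - p) / w2)"
  define B where "B = (\<lambda>e. (\<beta> (v0 + e) - p) / w2)"
  have eta_w2: "\<eta> * cmod w2 > 0" using \<eta> w2 by simp
  obtain d1 where "d1 > 0" and d1: "\<And>h. \<bar>h\<bar> < d1 \<Longrightarrow> cmod (\<alpha> (u0 + h) - \<alpha> u0 - h *\<^sub>R w1) \<le> \<eta> * cmod w2 * \<bar>h\<bar>"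
    using has_vector_derivative_remainder_bound[OF d\<alpha> eta_w2] by blast
  obtain d2 where "d2 > 0" and d2: "\<And>h. \<bar>h\<bar> < d2 \<Longrightarrow> cmod (\<beta> (v0 + h) - \<beta> v0 - h *\<^sub>R w2) \<le> \<eta> * cmod w2 * \<bar>h\<bar>"
    using has_vector_derivative_remainder_bound[OF d\<beta> eta_w2] by blast
  have A: "cmod (A h - of_real h * \<omega>) \<le> \<eta> * \<bar>h\<bar>" if "\<bar>h\<bar> < d1" for h
  proof -
    have "A h - of_real h * \<omega> = (\<alpha> (u0 + h) - \<alpha> u0 - h *\<^sub>R w1) / w2"
      using w2 by (simp add: A_def \<omega>_def p_def meet diff_divide_distrib scaleR_conv_of_real)
    then show ?thesis
      using d1[OF that] w2 by (simp add: norm_divide divide_le_eq mult_ac)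
  qed
  have B: "cmod (B h - of_real h) \<le> \<eta> * \<bar>h\<bar>" if "\<bar>h\<bar> < d2" for h
  proof -
    have "B h - of_real h = (\<beta> (v0 + h) - \<beta> v0 - h *\<^sub>R w2) / w2"
      using w2 by (simp add: B_def p_def diff_divide_distrib scaleR_conv_of_real)
    then show ?thesis
      using d2[OF that] w2 by (simp add: norm_divide divide_le_eq mult_ac)
  qed
  define \<delta> where "\<delta> = min (d1/2) (min u0 (1 - u0) / 2)"
  have \<delta>: "\<delta> > 0" "\<delta> < d1" "\<delta> < u0" "\<delta> < 1 - u0"
    using \<open>d1 > 0\<close> u0 by (auto simp: \<delta>_def min_def)
  have pos: "A h - B e \<notin> \<real>\<^sub>\<ge>\<^sub>0" if "\<bar>h\<bar> \<le> \<delta>" "0 < e" "e < d2" for h e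
    using transversal_crossing_cone[OF \<omega> \<eta> \<open>0 < e\<close>, of "A h" h "B e"] A[of h] B[of e] that \<delta> by auto
  \<comment> \<open>A half turn carries this side of the crossing to the other: the cone lemma is
    applied to \<open>- A h\<close> and \<open>- B (- e)\<close>.\<close>
  have neg: "A h - B (- e) \<notin> \<real>\<^sub>\<le>\<^sub>0" if "\<bar>h\<bar> \<le> \<delta>" "0 < e" "e < d2" for h e
  proof -
    have "cmod (- A h - of_real (- h) * \<omega>) \<le> \<eta> * \<bar>-h\<bar>"
      using A[of h] that \<delta> norm_minus_cancel[of "A h - of_real h * \<omega>"] by simp
    moreover have "cmod (- B (- e) - of_real e) \<le> \<eta> * e"
      using B[of "-e"] that norm_minus_cancel[of "- B (- e) - of_real e"] by (simp add: add.commute)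
    ultimately have "- A h - (- B (- e)) \<notin> \<real>\<^sub>\<ge>\<^sub>0"
      by (rule transversal_crossing_cone[OF \<omega> \<eta> \<open>0 < e\<close>])
    then show ?thesis
      by (auto simp: complex_nonpos_Reals_iff complex_nonneg_Reals_iff)
  qed
  \<comment> \<open>The ends of the middle piece lie strictly on opposite sides of the tangent line
    of \<beta>, hence off both cuts.\<close>
  have sgn_A: "Im (A \<delta>) * Im \<omega> > 0" "Im (A (-\<delta>)) * Im \<omega> < 0"
  proof -
    have "\<eta> < \<bar>Im \<omega>\<bar>"
    proof -
      have "\<bar>Im \<omega>\<bar> / (8 * (cmod \<omega> + 1)) \<le> \<bar>Im \<omega>\<bar> / 8"
        using \<omega> by (intro divide_left_mono) (auto simp: add_nonneg_pos)
      moreover have "\<bar>Im \<omega>\<bar> / 8 < \<bar>Im \<omega>\<bar>" using \<omega> by simp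
      ultimately show ?thesis using \<eta>(3) by linarith
    qed
    then have lt: "\<eta> * \<delta> < \<delta> * \<bar>Im \<omega>\<bar>" using \<delta> by simp
    have "\<bar>Im (A \<delta>) - \<delta> * Im \<omega>\<bar> \<le> \<eta> * \<delta>"
      using order.trans[OF abs_Im_le_cmod A[of \<delta>]] \<delta> by simp
    with lt have 1: "\<bar>Im (A \<delta>) - \<delta> * Im \<omega>\<bar> < \<delta> * \<bar>Im \<omega>\<bar>" by simp
    have "\<bar>Im (A (-\<delta>)) + \<delta> * Im \<omega>\<bar> \<le> \<eta> * \<delta>"
      using order.trans[OF abs_Im_le_cmod A[of "-\<delta>"]] \<delta> by simp
    with lt have 2: "\<bar>Im (A (-\<delta>)) + \<delta> * Im \<omega>\<bar> < \<delta> * \<bar>Im \<omega>\<bar>" by simp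
    show "Im (A \<delta>) * Im \<omega> > 0" "Im (A (-\<delta>)) * Im \<omega> < 0"
      using 1 2 \<omega> \<delta> by (cases "Im \<omega> > 0"; auto simp: zero_less_mult_iff mult_less_0_iff abs_if split: if_splits)+
  qed
  define \<gamma> where "\<gamma> = subpath (u0 - \<delta>) (u0 + \<delta>) \<alpha>"
  define \<gamma>1 where "\<gamma>1 = subpath 0 (u0 - \<delta>) \<alpha>"
  define \<gamma>2 where "\<gamma>2 = subpath (u0 + \<delta>) 1 \<alpha>"
  have paths: "path \<gamma>" "path \<gamma>1" "path \<gamma>2"
    using \<alpha> \<delta> u0 by (auto simp: \<gamma>_def \<gamma>1_def \<gamma>2_def intro!: path_subpath)
  have \<gamma>: "\<gamma> t = \<alpha> (u0 + (2 * t - 1) * \<delta>)" for t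
    by (simp add: \<gamma>_def subpath_def algebra_simps)
  have h_le: "\<bar>(2 * t - 1) * \<delta>\<bar> \<le> \<delta>" if "t \<in> {0..1}" for t
  proof -
    have "\<bar>2 * t - 1\<bar> * \<delta> \<le> 1 * \<delta>"
      using that \<delta> by (intro mult_right_mono) (auto simp: abs_le_iff)
    then show ?thesis using \<delta> by (simp add: abs_mult)
  qed
  have \<gamma>_pos: "winding_number \<gamma> (\<beta> (v0 + e)) = (Ln (- (A \<delta> - B e)) - Ln (- (A (-\<delta>) - B e))) / (2 * of_real pi * \<i>)"
    if "0 < e" "e < d2" for e
  proof -
    have eq: "(\<gamma> t - \<beta> (v0 + e)) / (- w2) = - (A ((2 * t - 1) * \<delta>) - B e)" for t
      using w2 by (simp add: \<gamma> A_def B_def field_simps)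
    have "winding_number \<gamma> (\<beta> (v0 + e)) = (Ln ((\<gamma> 1 - \<beta> (v0 + e)) / (- w2)) - Ln ((\<gamma> 0 - \<beta> (v0 + e)) / (- w2))) / (2 * of_real pi * \<i>)"
    proof (rule winding_number_eq_Ln[OF paths(1)])
      fix t :: real assume "t \<in> {0..1}"
      then show "(\<gamma> t - \<beta> (v0 + e)) / (- w2) \<notin> \<real>\<^sub>\<le>\<^sub>0"
        unfolding eq using pos[OF h_le that, of t] by (auto simp: complex_nonpos_Reals_iff complex_nonneg_Reals_iff)
    qed (use w2 in auto)
    then show ?thesis unfolding eq by simp
  qed
  have \<gamma>_neg: "winding_number \<gamma> (\<beta> (v0 - e)) = (Ln (A \<delta> - B (-e)) - Ln (A (-\<delta>) - B (-e))) / (2 * of_real pi * \<i>)"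
    if "0 < e" "e < d2" for e
  proof -
    have eq: "(\<gamma> t - \<beta> (v0 - e)) / w2 = A ((2 * t - 1) * \<delta>) - B (-e)" for t
      using w2 by (simp add: \<gamma> A_def B_def field_simps)
    have "winding_number \<gamma> (\<beta> (v0 - e)) = (Ln ((\<gamma> 1 - \<beta> (v0 - e)) / w2) - Ln ((\<gamma> 0 - \<beta> (v0 - e)) / w2)) / (2 * of_real pi * \<i>)"
    proof (rule winding_number_eq_Ln[OF paths(1)])
      fix t :: real assume "t \<in> {0..1}"
      then show "(\<gamma> t - \<beta> (v0 - e)) / w2 \<notin> \<real>\<^sub>\<le>\<^sub>0"
        unfolding eq using neg[OF h_le that] by simp
    qed (use w2 in auto)
    then show ?thesis unfolding eq by simp
  qed
  have \<gamma>_avoid: "\<beta> (v0 + e) \<notin> path_image \<gamma>" "\<beta> (v0 - e) \<notin> path_image \<gamma>" if "0 < e" "e < d2" for e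
  proof -
    have "\<gamma> t \<noteq> \<beta> (v0 + e)" "\<gamma> t \<noteq> \<beta> (v0 - e)" if t: "t \<in> {0..1}" for t
      using pos[OF h_le[OF t] \<open>0 < e\<close> \<open>e < d2\<close>] neg[OF h_le[OF t] \<open>0 < e\<close> \<open>e < d2\<close>]
      by (auto simp: \<gamma> A_def B_def)
    then show "\<beta> (v0 + e) \<notin> path_image \<gamma>" "\<beta> (v0 - e) \<notin> path_image \<gamma>"
      by (auto simp: path_image_def simp del: atLeastAtMost_iff; metis)+
  qed
  have "isCont \<beta> v0"
    using d\<beta> by (rule has_vector_derivative_continuous)
  then have \<beta>_lim: "((\<lambda>e. \<beta> (v0 + e)) \<longlongrightarrow> p) (at_right 0)" "((\<lambda>e. \<beta> (v0 - e)) \<longlongrightarrow> p) (at_right 0)"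
    unfolding p_def by (auto intro!: isCont_tendsto_compose[of v0 \<beta>] tendsto_eq_intros)
  then have B_lim: "(B \<longlongrightarrow> 0) (at_right 0)" "((\<lambda>e. B (-e)) \<longlongrightarrow> 0) (at_right 0)"
    unfolding B_def by (auto intro!: tendsto_eq_intros simp: w2)
  have avoid12: "p \<notin> path_image \<gamma>1" "p \<notin> path_image \<gamma>2"
  proof -
    have "\<alpha> u \<noteq> p" if "u \<in> {0..u0 - \<delta>} \<union> {u0 + \<delta>..1}" for u
      using uniq[of u] that \<delta> u0 by (auto simp: p_def)
    moreover have "path_image \<gamma>1 = \<alpha> ` {0..u0 - \<delta>}" "path_image \<gamma>2 = \<alpha> ` {u0 + \<delta>..1}"
      using \<delta> u0 by (auto simp: \<gamma>1_def \<gamma>2_def path_image_subpath)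
    ultimately show "p \<notin> path_image \<gamma>1" "p \<notin> path_image \<gamma>2"
      by (metis UnCI imageE)+
  qed
  have ev_avoid: "eventually (\<lambda>e. \<beta> (v0 + e) \<notin> path_image \<gamma>i \<and> \<beta> (v0 - e) \<notin> path_image \<gamma>i) (at_right 0)"
    and W_lim: "((\<lambda>e. winding_number \<gamma>i (\<beta> (v0 + e)) - winding_number \<gamma>i (\<beta> (v0 - e))) \<longlongrightarrow> 0) (at_right 0)"
    if "path \<gamma>i" "p \<notin> path_image \<gamma>i" for \<gamma>i
  proof -
    have "open (- path_image \<gamma>i)" using closed_path_image[OF that(1)] by (simp add: open_Compl)
    then show "eventually (\<lambda>e. \<beta> (v0 + e) \<notin> path_image \<gamma>i \<and> \<beta> (v0 - e) \<notin> path_image \<gamma>i) (at_right 0)"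
      using topological_tendstoD[OF \<beta>_lim(1), of "- path_image \<gamma>i"] topological_tendstoD[OF \<beta>_lim(2), of "- path_image \<gamma>i"] that
      by (auto elim: eventually_elim2)
    have "isCont (winding_number \<gamma>i) p" using continuous_at_winding_number[OF that] .
    from tendsto_diff[OF isCont_tendsto_compose[OF this \<beta>_lim(1)] isCont_tendsto_compose[OF this \<beta>_lim(2)]]
    show "((\<lambda>e. winding_number \<gamma>i (\<beta> (v0 + e)) - winding_number \<gamma>i (\<beta> (v0 - e))) \<longlongrightarrow> 0) (at_right 0)"
      by simp
  qed
  have split: "winding_number \<alpha> z = winding_number \<gamma>1 z + winding_number \<gamma> z + winding_number \<gamma>2 z"
    if "z \<notin> path_image \<gamma>1" "z \<notin> path_image \<gamma>" "z \<notin> path_image \<gamma>2" for z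
  proof -
    have "{0..1} = {0..u0 - \<delta>} \<union> {u0 - \<delta>..u0 + \<delta>} \<union> {u0 + \<delta>..1}"
      using \<delta> u0 by auto
    then have "path_image \<alpha> = path_image \<gamma>1 \<union> path_image \<gamma> \<union> path_image \<gamma>2"
      using \<delta> u0 by (simp add: path_image_def[of \<alpha>] \<gamma>1_def \<gamma>2_def \<gamma>_def path_image_subpath image_Un)
    then have "z \<notin> path_image \<alpha>" using that by auto
    then show ?thesis
      using winding_number_subpath_combine[OF \<alpha>, of z 0 "u0 - \<delta>" "u0 + \<delta>"]
        winding_number_subpath_combine[OF \<alpha>, of z 0 "u0 + \<delta>" 1] \<delta> u0
      by (simp add: \<gamma>1_def \<gamma>2_def \<gamma>_def)
  qed
  \<comment> \<open>At the crossing itself \<open>B\<close> vanishes, which gives the limits of the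
    two logarithmic expressions. \<open>Ln (- A)\<close> differs from \<open>Ln A\<close> by half a
    turn at each end, in opposite senses; together this is one full turn.\<close>
  define k where "k = (Ln (- A \<delta>) - Ln (- A (-\<delta>))) / (2 * of_real pi * \<i>) - (Ln (A \<delta>) - Ln (A (-\<delta>))) / (2 * of_real pi * \<i>)"
  have nonreal: "A \<delta> \<notin> \<real>\<^sub>\<le>\<^sub>0" "A (-\<delta>) \<notin> \<real>\<^sub>\<le>\<^sub>0" "- A \<delta> \<notin> \<real>\<^sub>\<le>\<^sub>0" "- A (-\<delta>) \<notin> \<real>\<^sub>\<le>\<^sub>0"
    using sgn_A by (auto simp: complex_nonpos_Reals_iff)
  have "((\<lambda>e. (Ln (- (A \<delta> - B e)) - Ln (- (A (-\<delta>) - B e))) / (2 * of_real pi * \<i>)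
         - (Ln (A \<delta> - B (-e)) - Ln (A (-\<delta>) - B (-e))) / (2 * of_real pi * \<i>)) \<longlongrightarrow> k) (at_right 0)"
    unfolding k_def by (rule tendsto_eq_intros B_lim refl | use nonreal in simp)+
  moreover have ev: "eventually (\<lambda>e. 0 < e \<and> e < d2) (at_right 0)"
    using \<open>d2 > 0\<close> by (auto simp: eventually_at_right)
  then have "eventually (\<lambda>e. (Ln (- (A \<delta> - B e)) - Ln (- (A (-\<delta>) - B e))) / (2 * of_real pi * \<i>)
         - (Ln (A \<delta> - B (-e)) - Ln (A (-\<delta>) - B (-e))) / (2 * of_real pi * \<i>)
         = winding_number \<gamma> (\<beta> (v0 + e)) - winding_number \<gamma> (\<beta> (v0 - e))) (at_right 0)"
    by eventually_elim (simp add: \<gamma>_pos \<gamma>_neg)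
  ultimately have "((\<lambda>e. winding_number \<gamma> (\<beta> (v0 + e)) - winding_number \<gamma> (\<beta> (v0 - e))) \<longlongrightarrow> k) (at_right 0)"
    by (rule Lim_transform_eventually)
  from tendsto_add[OF tendsto_add[OF this W_lim[OF paths(2) avoid12(1)]] W_lim[OF paths(3) avoid12(2)]]
  have "((\<lambda>e. (winding_number \<gamma> (\<beta> (v0 + e)) - winding_number \<gamma> (\<beta> (v0 - e)))
     + (winding_number \<gamma>1 (\<beta> (v0 + e)) - winding_number \<gamma>1 (\<beta> (v0 - e)))
     + (winding_number \<gamma>2 (\<beta> (v0 + e)) - winding_number \<gamma>2 (\<beta> (v0 - e)))) \<longlongrightarrow> k) (at_right 0)"
    by simp
  moreover have "eventually (\<lambda>e. (winding_number \<gamma> (\<beta> (v0 + e)) - winding_number \<gamma> (\<beta> (v0 - e)))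
     + (winding_number \<gamma>1 (\<beta> (v0 + e)) - winding_number \<gamma>1 (\<beta> (v0 - e)))
     + (winding_number \<gamma>2 (\<beta> (v0 + e)) - winding_number \<gamma>2 (\<beta> (v0 - e)))
     = winding_number \<alpha> (\<beta> (v0 + e)) - winding_number \<alpha> (\<beta> (v0 - e))) (at_right 0)"
    using ev ev_avoid[OF paths(2) avoid12(1)] ev_avoid[OF paths(3) avoid12(2)]
    by eventually_elim (simp add: split \<gamma>_avoid)
  ultimately have lim: "((\<lambda>e. winding_number \<alpha> (\<beta> (v0 + e)) - winding_number \<alpha> (\<beta> (v0 - e))) \<longlongrightarrow> k) (at_right 0)"
    by (rule Lim_transform_eventually)
  have "k = 1 \<or> k = -1"
  proof (cases "Im \<omega> > 0")
    case True
    then have "Im (A \<delta>) > 0" "Im (A (-\<delta>)) < 0"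
      using sgn_A by (auto simp: zero_less_mult_iff mult_less_0_iff)
    then have "Ln (- A \<delta>) = Ln (A \<delta>) - \<i> * pi" "Ln (- A (-\<delta>)) = Ln (A (-\<delta>)) + \<i> * pi"
      by (subst Ln_minus; force)+
    note Ln_eqs = this
    have "k = - 1"
      unfolding k_def Ln_eqs by (simp add: field_simps)
    then show ?thesis by simp
  next
    case False
    then have "Im (A \<delta>) < 0" "Im (A (-\<delta>)) > 0"
      using sgn_A \<omega> by (auto simp: zero_less_mult_iff mult_less_0_iff)
    then have "Ln (- A \<delta>) = Ln (A \<delta>) + \<i> * pi" "Ln (- A (-\<delta>)) = Ln (A (-\<delta>)) - \<i> * pi"
      by (subst Ln_minus; force)+
    note Ln_eqs = this
    have "k = 1"
      unfolding k_def Ln_eqs by (simp add: field_simps)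
    then show ?thesis by simp
  qed
  then show thesis using lim by (rule that)
qed

section \<open>Parity of the winding number along a strand of the curve\<close>

text \<open>Winding numbers are complex-valued. The predicate expresses parity where the value is an
  integer, as for a closed loop and a point off it, and is false at any other value.\<close>

definition even_winding :: "(real \<Rightarrow> complex) \<Rightarrow> complex \<Rightarrow> bool" where
  "even_winding \<alpha> z \<longleftrightarrow> (\<exists>m::int. even m \<and> winding_number \<alpha> z = of_int m)"

lemma even_winding_iff:
  "winding_number \<alpha> z = of_int m \<Longrightarrow> even_winding \<alpha> z \<longleftrightarrow> even m"
  by (auto simp: even_winding_def)

text \<open>The arc may run backwards (\<open>d < c\<close>), as the return arc of a loop does. The
  factor \<open>d - c\<close> of the chain rule is a nonzero real and leaves transversality
  intact.\<close>

lemma winding_number_subpath_jump: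
  fixes \<Gamma> D :: "real \<Rightarrow> complex"
  assumes deriv: "\<And>t. (\<Gamma> has_vector_derivative D t) (at t)"
    and "c \<noteq> d" and u: "u \<in> open_segment c d"
    and uniq: "\<And>u'. u' \<in> closed_segment c d \<Longrightarrow> \<Gamma> u' = \<Gamma> v \<Longrightarrow> u' = u"
    and meet: "\<Gamma> u = \<Gamma> v" and transversal: "Im (D u * cnj (D v)) \<noteq> 0"
  obtains k where "k = 1 \<or> k = -1"
    "((\<lambda>e. winding_number (subpath c d \<Gamma>) (\<Gamma> (v + e)) - winding_number (subpath c d \<Gamma>) (\<Gamma> (v - e)))
      \<longlongrightarrow> k) (at_right 0)"
proof -
  obtain r where r: "0 < r" "r < 1" and "u = (1 - r) *\<^sub>R c + r *\<^sub>R d"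
    using u by (auto simp: in_segment)
  then have u_eq: "u = (d - c) * r + c" by (simp add: algebra_simps)
  have cont: "continuous_on UNIV \<Gamma>"
    using deriv has_vector_derivative_continuous by (blast intro: continuous_at_imp_continuous_on)
  have path: "path (subpath c d \<Gamma>)"
    unfolding path_def subpath_def by (intro continuous_on_compose2[OF cont] continuous_intros) auto
  have "((\<lambda>t. (d - c) * t + c) has_vector_derivative (d - c)) (at r)"
    by (auto intro!: derivative_eq_intros)
  then have "(\<Gamma> \<circ> (\<lambda>t. (d - c) * t + c) has_vector_derivative (d - c) *\<^sub>R D u) (at r)"
    by (rule vector_diff_chain_at) (use deriv u_eq in simp)
  then have "(subpath c d \<Gamma> has_vector_derivative (d - c) *\<^sub>R D u) (at r)"
    by (simp add: subpath_def o_def)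
  moreover have "Im ((d - c) *\<^sub>R D u * cnj (D v)) \<noteq> 0"
    using transversal \<open>c \<noteq> d\<close> by (simp flip: right_diff_distrib)
  moreover have "t = r" if "t \<in> {0..1}" "subpath c d \<Gamma> t = \<Gamma> v" for t
  proof -
    have "(d - c) * t + c = (1 - t) *\<^sub>R c + t *\<^sub>R d" by (simp add: algebra_simps)
    then have "(d - c) * t + c \<in> closed_segment c d"
      using that(1) unfolding in_segment by auto
    then have "(d - c) * t + c = u"
      using that(2) uniq by (simp add: subpath_def)
    then show ?thesis using \<open>c \<noteq> d\<close> by (simp add: u_eq)
  qed
  moreover have "subpath c d \<Gamma> r = \<Gamma> v"
    using meet by (simp add: subpath_def u_eq)
  moreover have "r \<in> {0<..<1}" using r by simp
  ultimately show thesis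
    using winding_number_jump[OF path _ _ _ _ deriv[of v], of r] that by blast
qed

text \<open>Off \<open>Z\<close> the strand stays in one component of the complement, so the parity
  is constant. At a crossing exactly one of the two arcs is met, in its interior: its winding number
  jumps by 1 or -1 in the limit, while that of the other arc is continuous. Finiteness of
  \<open>Z\<close> allows these changes to be added up.\<close>

lemma even_winding_parity:
  fixes \<Gamma> D :: "real \<Rightarrow> complex"
  assumes deriv: "\<And>t. (\<Gamma> has_vector_derivative D t) (at t)"
    and ab: "a < b" "a' \<le> b'" "\<Gamma> a = \<Gamma> a'" "\<Gamma> b = \<Gamma> b'"
    and K: "K = {a..b} \<union> {a'..b'}"
    and \<alpha>: "\<alpha> = subpath a b \<Gamma> +++ subpath b' a' \<Gamma>"
    and xy: "x \<le> y" "\<Gamma> x \<notin> \<Gamma> ` K" "\<Gamma> y \<notin> \<Gamma> ` K"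
    and Z: "Z = {v \<in> {x..y}. \<Gamma> v \<in> \<Gamma> ` K}" and fin: "finite Z"
    and cross: "\<And>v. v \<in> Z \<Longrightarrow> \<exists>u. (u \<in> {a<..<b} - {a'..b'} \<or> u \<in> {a'<..<b'} - {a..b}) \<and> \<Gamma> u = \<Gamma> v
        \<and> (\<forall>u'\<in>K. \<Gamma> u' = \<Gamma> v \<longrightarrow> u' = u) \<and> Im (D u * cnj (D v)) \<noteq> 0"
  shows "(even_winding \<alpha> (\<Gamma> x) \<longleftrightarrow> even_winding \<alpha> (\<Gamma> y)) \<longleftrightarrow> even (card Z)"
proof -
  have cont: "continuous_on UNIV \<Gamma>"
    using deriv has_vector_derivative_continuous by (blast intro: continuous_at_imp_continuous_on)
  then have cont': "isCont \<Gamma> t" for t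
    by (simp add: continuous_on_eq_continuous_at)
  have path_sub: "path (subpath c d \<Gamma>)" for c d
    unfolding path_def subpath_def by (intro continuous_on_compose2[OF cont] continuous_intros) auto
  have \<alpha>_path: "path \<alpha>" and \<alpha>_loop: "pathfinish \<alpha> = pathstart \<alpha>"
    using path_sub ab by (simp_all add: \<alpha>)
  have \<alpha>_image: "path_image \<alpha> = \<Gamma> ` K"
    using ab by (simp add: \<alpha> K path_image_join path_image_subpath image_Un)
  have W: "winding_number \<alpha> q = winding_number (subpath a b \<Gamma>) q + winding_number (subpath b' a' \<Gamma>) q"
    if "q \<notin> \<Gamma> ` K" for q
    unfolding \<alpha> using that ab path_sub
    by (intro winding_number_join) (auto simp: K path_image_subpath)
  have W_int: "winding_number \<alpha> q \<in> \<int>" if "q \<notin> \<Gamma> ` K" for q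
    using integer_winding_number[OF \<alpha>_path \<alpha>_loop] that \<alpha>_image by simp
  have no_crossing: "even_winding \<alpha> (\<Gamma> p) \<longleftrightarrow> even_winding \<alpha> (\<Gamma> q)"
    if "p \<le> q" "p \<in> {x..y}" "q \<in> {x..y}" "{p..q} \<inter> Z = {}" for p q
  proof -
    have "winding_number \<alpha> (\<Gamma> p) = winding_number \<alpha> (\<Gamma> q)"
    proof (rule winding_number_eq[OF \<alpha>_path \<alpha>_loop, of _ "\<Gamma> ` {p..q}"])
      show "connected (\<Gamma> ` {p..q})"
        using cont by (intro connected_continuous_image) (auto intro: continuous_on_subset)
      show "\<Gamma> ` {p..q} \<inter> path_image \<alpha> = {}"
        using that unfolding \<alpha>_image Z by fastforce
    qed (use that in auto)
    then show ?thesis by (simp add: even_winding_def)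
  qed
  have jump: "\<exists>e0>0. \<forall>e. 0 < e \<and> e < e0 \<longrightarrow> even_winding \<alpha> (\<Gamma> (v + e)) \<noteq> even_winding \<alpha> (\<Gamma> (v - e))"
    if v: "v \<in> Z" for v
  proof -
    obtain u where u: "u \<in> {a<..<b} - {a'..b'} \<or> u \<in> {a'<..<b'} - {a..b}" and meet: "\<Gamma> u = \<Gamma> v"
      and uniq: "\<And>u'. u' \<in> K \<Longrightarrow> \<Gamma> u' = \<Gamma> v \<Longrightarrow> u' = u" and transversal: "Im (D u * cnj (D v)) \<noteq> 0"
      using cross[OF v] by metis
    have \<Gamma>_lim: "((\<lambda>e. \<Gamma> (v + e)) \<longlongrightarrow> \<Gamma> v) (at_right 0)" "((\<lambda>e. \<Gamma> (v - e)) \<longlongrightarrow> \<Gamma> v) (at_right 0)"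
      by (auto intro!: isCont_tendsto_compose[of v \<Gamma>] cont' tendsto_eq_intros)
    have W_lim: "((\<lambda>e. winding_number (subpath c d \<Gamma>) (\<Gamma> (v + e)) - winding_number (subpath c d \<Gamma>) (\<Gamma> (v - e))) \<longlongrightarrow> 0) (at_right 0)"
      if "\<Gamma> v \<notin> path_image (subpath c d \<Gamma>)" for c d
    proof -
      have "isCont (winding_number (subpath c d \<Gamma>)) (\<Gamma> v)"
        using continuous_at_winding_number[OF path_sub that] .
      from tendsto_diff[OF isCont_tendsto_compose[OF this \<Gamma>_lim(1)] isCont_tendsto_compose[OF this \<Gamma>_lim(2)]]
      show ?thesis by simp
    qed
    obtain k where k: "k = 1 \<or> k = -1" and lim:
      "((\<lambda>e. (winding_number (subpath a b \<Gamma>) (\<Gamma> (v + e)) - winding_number (subpath a b \<Gamma>) (\<Gamma> (v - e)))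
         + (winding_number (subpath b' a' \<Gamma>) (\<Gamma> (v + e)) - winding_number (subpath b' a' \<Gamma>) (\<Gamma> (v - e)))) \<longlongrightarrow> k) (at_right 0)"
    proof (cases "u \<in> {a<..<b} - {a'..b'}")
      case True
      obtain k where k: "k = 1 \<or> k = -1" "((\<lambda>e. winding_number (subpath a b \<Gamma>) (\<Gamma> (v + e)) - winding_number (subpath a b \<Gamma>) (\<Gamma> (v - e)))
         \<longlongrightarrow> k) (at_right 0)"
        using winding_number_subpath_jump[OF deriv, of a b u v] True ab uniq meet transversal
        by (auto simp: open_segment_eq_real_ivl closed_segment_eq_real_ivl K)
      have "\<Gamma> v \<notin> path_image (subpath b' a' \<Gamma>)"
      proof -
        have "\<Gamma> t \<noteq> \<Gamma> v" if "t \<in> {a'..b'}" for t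
          using uniq[of t] True that by (auto simp: K)
        then show ?thesis
          using ab by (auto simp: path_image_subpath image_iff simp del: atLeastAtMost_iff; metis)
      qed
      from that[OF k(1)] tendsto_add[OF k(2) W_lim[OF this]] show thesis by simp
    next
      case False
      then have u': "u \<in> {a'<..<b'} - {a..b}" using u by blast
      obtain k where k: "k = 1 \<or> k = -1" "((\<lambda>e. winding_number (subpath b' a' \<Gamma>) (\<Gamma> (v + e)) - winding_number (subpath b' a' \<Gamma>) (\<Gamma> (v - e)))
         \<longlongrightarrow> k) (at_right 0)"
        using winding_number_subpath_jump[OF deriv, of b' a' u v] u' ab uniq meet transversal
        by (auto simp: open_segment_eq_real_ivl closed_segment_eq_real_ivl K)
      have "\<Gamma> v \<notin> path_image (subpath a b \<Gamma>)"
      proof -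
        have "\<Gamma> t \<noteq> \<Gamma> v" if "t \<in> {a..b}" for t
          using uniq[of t] u' that by (auto simp: K)
        then show ?thesis
          using ab by (auto simp: path_image_subpath image_iff simp del: atLeastAtMost_iff; metis)
      qed
      from that[OF k(1)] tendsto_add[OF W_lim[OF this] k(2)] show thesis by simp
    qed
    have "v \<noteq> x" "v \<noteq> y" using xy v by (auto simp: Z)
    then have vxy: "x < v" "v < y" using v by (auto simp: Z)
    obtain d where "d > 0" and d: "\<And>w. w \<in> Z \<Longrightarrow> w \<noteq> v \<Longrightarrow> d \<le> dist v w"
      using finite_set_avoid[OF fin] by metis
    have off: "\<Gamma> (v + e) \<notin> \<Gamma> ` K \<and> \<Gamma> (v - e) \<notin> \<Gamma> ` K" if "0 < e" "e < min d (min (v - x) (y - v))" for e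
      using d[of "v + e"] d[of "v - e"] that vxy by (auto simp: Z dist_real_def)
    have "eventually (\<lambda>e. e < min d (min (v - x) (y - v))) (at_right 0)"
      using \<open>d > 0\<close> vxy by (intro order_tendstoD(2)[OF tendsto_ident_at]) auto
    moreover have "eventually (\<lambda>e::real. 0 < e) (at_right 0)"
      by (simp add: eventually_at_right_less)
    moreover note tendstoD[OF lim, of 1, simplified]
    ultimately have "eventually (\<lambda>e. even_winding \<alpha> (\<Gamma> (v + e)) \<noteq> even_winding \<alpha> (\<Gamma> (v - e))) (at_right 0)"
    proof eventually_elim
      case (elim e)
      obtain m where m: "winding_number \<alpha> (\<Gamma> (v + e)) = of_int m"
        using W_int off[OF elim(2,1)] by (meson Ints_cases)
      obtain m' where m': "winding_number \<alpha> (\<Gamma> (v - e)) = of_int m'"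
        using W_int off[OF elim(2,1)] by (meson Ints_cases)
      obtain k' :: int where k': "k = of_int k'" "odd k'" using k by (metis of_int_1 of_int_minus odd_one even_minus)
      \<comment> \<open>For the closed loop both values are integers, so a difference at distance
        less than 1 from the odd integer \<open>k'\<close> equals it.\<close>
      have "cmod (of_int m - of_int m' - of_int k') < 1"
        using elim(3) W off[OF elim(2,1)] by (simp add: dist_norm m[symmetric] m'[symmetric] k' algebra_simps)
      then have "cmod (of_int (m - m' - k')) < 1" by simp
      then have "m - m' - k' = 0" unfolding norm_of_int by linarith
      then have "m = m' + k'" by simp
      then show ?case using even_winding_iff[OF m] even_winding_iff[OF m'] k' by auto
    qed
    then show ?thesis
      by (auto simp: eventually_at_right_field)
  qed
  show ?thesis
  proof (cases "x = y")
    case True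
    then have "Z = {}" using xy by (auto simp: Z)
    then show ?thesis using True by simp
  next
    case False
    then have "x < y" using xy by simp
    \<comment> \<open>\<open>Q v\<close> says that the parity change from \<open>x\<close> to
      \<open>v\<close> matches the number of crossings up to \<open>v\<close>. Connectedness carries
      it from \<open>x\<close> to \<open>y\<close>, testing only points off \<open>Z\<close>, where
      the parity is meaningful.\<close>
    define Q where "Q v \<longleftrightarrow> ((even_winding \<alpha> (\<Gamma> x) \<longleftrightarrow> even_winding \<alpha> (\<Gamma> v)) \<longleftrightarrow> even (card (Z \<inter> {..v})))" for v
    have "Q y"
    proof (rule connected_induction[of "{x..y}" "\<lambda>v. v \<notin> Z" Q x y])
      fix T v assume T: "openin (top_of_set {x..y}) T" "v \<in> T"
      then obtain V where V: "open V" "T = {x..y} \<inter> V" by (auto simp: openin_open)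
      have "v islimpt {x..y}" using T V \<open>x < y\<close> by (simp add: islimpt_Icc)
      then have "infinite (V \<inter> {x..y})"
        using V T by (auto simp: islimpt_eq_acc_point)
      then have "\<not> V \<inter> {x..y} \<subseteq> Z" using fin finite_subset by blast
      then show "\<exists>z. z \<in> T \<and> z \<notin> Z" using V by blast
    next
      fix v assume v: "v \<in> {x..y}"
      obtain d where "d > 0" and d: "\<And>w. w \<in> Z \<Longrightarrow> w \<noteq> v \<Longrightarrow> d \<le> dist v w"
        using finite_set_avoid[OF fin] by metis
      \<comment> \<open>The only possible crossing in \<open>T\<close> is \<open>v\<close>, so two
        of its points are separated by at most one jump.\<close>
      define T where "T = {x..y} \<inter> {v - d<..<v + d}"
      have *: "Q p \<longleftrightarrow> Q q" if pq: "p \<in> T" "q \<in> T" "p \<notin> Z" "q \<notin> Z" "p < q" for p q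
      proof (cases "v \<in> Z \<and> p < v \<and> v < q")
        case True
        then obtain e0 where "e0 > 0" and e0: "\<And>e. 0 < e \<Longrightarrow> e < e0 \<Longrightarrow> even_winding \<alpha> (\<Gamma> (v + e)) \<noteq> even_winding \<alpha> (\<Gamma> (v - e))"
          using jump[of v] by blast
        define e where "e = min (e0/2) (min (v - p) (q - v))"
        have e: "0 < e" "e < e0" "p \<le> v - e" "v + e \<le> q"
          using True \<open>e0 > 0\<close> by (auto simp: e_def min_def)
        have sub: "Z \<inter> {p..q} \<subseteq> {v}"
          using d pq by (fastforce simp: T_def dist_real_def)
        have "even_winding \<alpha> (\<Gamma> p) \<longleftrightarrow> even_winding \<alpha> (\<Gamma> (v - e))"
          using sub pq e True by (intro no_crossing) (auto simp: T_def)
        moreover have "even_winding \<alpha> (\<Gamma> (v + e)) \<longleftrightarrow> even_winding \<alpha> (\<Gamma> q)"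
          using sub pq e True by (intro no_crossing) (auto simp: T_def)
        moreover have "Z \<inter> {..q} = insert v (Z \<inter> {..p})" "v \<notin> Z \<inter> {..p}"
          using sub True pq by (auto simp: not_le)
        then have "card (Z \<inter> {..q}) = Suc (card (Z \<inter> {..p}))" using fin by simp
        ultimately show ?thesis using e0[OF e(1,2)] by (auto simp: Q_def)
      next
        case False
        have "Z \<inter> {p..q} \<subseteq> {v}"
          using d pq by (fastforce simp: T_def dist_real_def)
        then have "{p..q} \<inter> Z = {}" using False pq by (force simp: le_less)
        moreover have "w \<le> p" if "w \<in> Z" "w \<le> q" for w
        proof (rule ccontr)
          assume "\<not> w \<le> p"
          then have "w \<in> {p..q} \<inter> Z" using that by simp
          then show False using \<open>{p..q} \<inter> Z = {}\<close> by simp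
        qed
        then have "Z \<inter> {..q} = Z \<inter> {..p}"
          using pq by auto
        ultimately show ?thesis using no_crossing[of p q] pq by (auto simp: Q_def T_def)
      qed
      have "openin (top_of_set {x..y}) T" unfolding T_def by (intro openin_open_Int) auto
      moreover have "v \<in> T" using v \<open>d > 0\<close> by (auto simp: T_def)
      moreover have "\<forall>p\<in>T. \<forall>q\<in>T. p \<notin> Z \<and> q \<notin> Z \<and> Q p \<longrightarrow> Q q"
        using * by (metis linorder_neqE_linordered_idom)
      ultimately show "\<exists>T. openin (top_of_set {x..y}) T \<and> v \<in> T \<and> (\<forall>p\<in>T. \<forall>q\<in>T. p \<notin> Z \<and> q \<notin> Z \<and> Q p \<longrightarrow> Q q)"
        by blast
    next
      have "Z \<inter> {..x} = {}" using xy by (force simp: Z le_less)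
      then show "Q x" by (simp add: Q_def)
    qed (use xy in \<open>auto simp: Z\<close>)
    moreover have "Z \<inter> {..y} = Z" by (auto simp: Z)
    ultimately show ?thesis by (simp add: Q_def)
  qed
qed

subsection \<open>Crossing parity for loops in a generic plane curve\<close>

lemma cis_eq_iff_int: "cis s = cis t \<longleftrightarrow> (\<exists>n::int. s = t + 2 * pi * n)"
  using sin_cos_eq_iff[of s t] by (auto simp: complex_eq_iff)

lemma inj_on_cis: "inj_on cis {w..<w + 2 * pi}"
proof
  fix s t assume st: "s \<in> {w..<w + 2 * pi}" "t \<in> {w..<w + 2 * pi}" "cis s = cis t"
  then obtain n :: int where n: "s = t + 2 * pi * n" by (auto simp: cis_eq_iff_int)
  then have "\<bar>2 * pi * n\<bar> < 2 * pi" using st by auto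
  then have "\<bar>real_of_int n\<bar> < 1" by (simp add: abs_mult)
  then have "n = 0" by linarith
  then show "s = t" using n by simp
qed

section \<open>Segments near a corner\<close>

text \<open>Quantitative linear independence: multiplying by \<open>cnj W\<close> or
  \<open>cnj V\<close> and taking imaginary parts isolates \<open>x\<close> or \<open>y\<close>, up
  to the determinant \<open>Im (V * cnj W)\<close>.\<close>

lemma norm_lin_comb_ge:
  fixes V W :: complex
  assumes "Im (V * cnj W) \<noteq> 0"
  obtains c where "c > 0" "\<And>x y. cmod (x *\<^sub>R V + y *\<^sub>R W) \<ge> c * (\<bar>x\<bar> + \<bar>y\<bar>)"
proof -
  define \<Delta> where "\<Delta> = \<bar>Im (V * cnj W)\<bar>"
  have "V \<noteq> 0" "W \<noteq> 0" using assms by auto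
  then have VW: "cmod V + cmod W > 0" by (simp add: add_pos_pos)
  show thesis
  proof (rule that[of "\<Delta> / (cmod V + cmod W)"])
    show "\<Delta> / (cmod V + cmod W) > 0" using assms VW by (simp add: \<Delta>_def)
    fix x y :: real
    define q where "q = x *\<^sub>R V + y *\<^sub>R W"
    have "Im (q * cnj W) = x * Im (V * cnj W)" "Im (q * cnj V) = - y * Im (V * cnj W)"
      by (simp_all add: q_def algebra_simps)
    then have "\<bar>Im (q * cnj W)\<bar> = \<bar>x\<bar> * \<Delta>" "\<bar>Im (q * cnj V)\<bar> = \<bar>y\<bar> * \<Delta>"
      by (simp_all only: \<Delta>_def abs_mult abs_minus_cancel)
    then have "\<bar>x\<bar> * \<Delta> \<le> cmod q * cmod W" "\<bar>y\<bar> * \<Delta> \<le> cmod q * cmod V"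
      using abs_Im_le_cmod[of "q * cnj W"] abs_Im_le_cmod[of "q * cnj V"] by (simp_all add: norm_mult)
    then have "(\<bar>x\<bar> + \<bar>y\<bar>) * \<Delta> \<le> cmod q * (cmod V + cmod W)"
      by (simp add: algebra_simps)
    then show "\<Delta> / (cmod V + cmod W) * (\<bar>x\<bar> + \<bar>y\<bar>) \<le> cmod (x *\<^sub>R V + y *\<^sub>R W)"
      using VW by (simp add: q_def divide_le_eq mult.commute)
  qed
qed

text \<open>Up to the remainders, the difference of the two points has coefficients
  \<open>(1 - \<mu>) * e + h\<close> along \<open>V\<close> and \<open>\<mu> * e\<close> along
  \<open>W\<close>, both nonnegative, with sum \<open>e + h\<close>. Its length is at least
  \<open>c * (e + h)\<close>, four times what the remainders can compensate.\<close>

lemma sector_avoids: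
  fixes V W :: complex
  assumes c: "\<And>x y. cmod (x *\<^sub>R V + y *\<^sub>R W) \<ge> c * (\<bar>x\<bar> + \<bar>y\<bar>)" and "c > 0"
    and "0 \<le> h" "e > 0" "0 \<le> \<mu>" "\<mu> \<le> 1"
    and r: "cmod r \<le> c/4 * h" "cmod r1 \<le> c/4 * e" "cmod r2 \<le> c/4 * e"
  shows "(1 - \<mu>) *\<^sub>R (p - e *\<^sub>R V + r1) + \<mu> *\<^sub>R (p - e *\<^sub>R W + r2) \<noteq> p + h *\<^sub>R V + r"
proof
  assume eq: "(1 - \<mu>) *\<^sub>R (p - e *\<^sub>R V + r1) + \<mu> *\<^sub>R (p - e *\<^sub>R W + r2) = p + h *\<^sub>R V + r"
  have "((1 - \<mu>) * e + h) *\<^sub>R V + (\<mu> * e) *\<^sub>R W = ((1 - \<mu>) *\<^sub>R r1 + \<mu> *\<^sub>R r2) - r"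
    using eq by (simp add: algebra_simps scaleR_conv_of_real)
  moreover have "c * (((1 - \<mu>) * e + h) + (\<mu> * e)) \<le> cmod (((1 - \<mu>) * e + h) *\<^sub>R V + (\<mu> * e) *\<^sub>R W)"
    using c[of "(1 - \<mu>) * e + h" "\<mu> * e"] assms by simp
  moreover have "cmod (((1 - \<mu>) *\<^sub>R r1 + \<mu> *\<^sub>R r2) - r) \<le> c/4 * e + c/4 * h"
  proof -
    have "cmod ((1 - \<mu>) *\<^sub>R r1 + \<mu> *\<^sub>R r2) \<le> (1 - \<mu>) * cmod r1 + \<mu> * cmod r2"
      using norm_triangle_ineq[of "(1 - \<mu>) *\<^sub>R r1" "\<mu> *\<^sub>R r2"] assms by simp
    also have "\<dots> \<le> (1 - \<mu>) * (c/4 * e) + \<mu> * (c/4 * e)"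
      using assms by (intro add_mono mult_left_mono) auto
    also have "\<dots> = c/4 * e" by (simp add: field_simps)
    finally show ?thesis
      using norm_triangle_ineq4[of "(1 - \<mu>) *\<^sub>R r1 + \<mu> *\<^sub>R r2" r] r(1) by linarith
  qed
  ultimately have "c * (((1 - \<mu>) * e + h) + (\<mu> * e)) \<le> c/4 * e + c/4 * h" by simp
  then have "c * (e + h) \<le> c/4 * (e + h)" by (simp add: algebra_simps)
  moreover have "c * (e + h) > 0" using assms by simp
  ultimately show False by simp
qed

text \<open>
  \<open>K\<close> contains at most one half of each branch through the double point. The endpoints of the
  segment move on the two opposite halves, which bound a common sector of the complement.
\<close>
lemma eventually_segment_avoids_corner:
  fixes \<Gamma> D :: "real \<Rightarrow> complex"
  assumes deriv: "\<And>t. (\<Gamma> has_vector_derivative D t) (at t)"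
    and meet: "\<Gamma> s = \<Gamma> t" and transversal: "Im (D s * cnj (D t)) \<noteq> 0"
    and sign: "\<bar>\<sigma>\<bar> = 1" "\<bar>\<tau>\<bar> = 1" and "compact K"
    and only: "\<And>u. u \<in> K \<Longrightarrow> \<Gamma> u = \<Gamma> s \<Longrightarrow> u = s \<or> u = t"
    and "d > 0"
    and side_s: "\<And>u. u \<in> K \<Longrightarrow> \<bar>u - s\<bar> < d \<Longrightarrow> \<sigma> * (u - s) \<ge> 0"
    and side_t: "\<And>u. u \<in> K \<Longrightarrow> \<bar>u - t\<bar> < d \<Longrightarrow> \<tau> * (u - t) \<ge> 0"
  shows "eventually (\<lambda>e. closed_segment (\<Gamma> (s - \<sigma> * e)) (\<Gamma> (t - \<tau> * e)) \<inter> \<Gamma> ` K = {}) (at_right 0)"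
proof -
  \<comment> \<open>\<open>V\<close> and \<open>W\<close> point along the halves that may belong to
    \<open>K\<close>; the ends of the segment lie on the other halves.\<close>
  define V where "V = \<sigma> *\<^sub>R D s"
  define W where "W = \<tau> *\<^sub>R D t"
  define p where "p = \<Gamma> s"
  have \<sigma>\<tau>: "\<sigma> * \<sigma> = 1" "\<tau> * \<tau> = 1" using sign by (metis abs_mult_self_eq mult_1)+
  have "Im (V * cnj W) = (\<sigma> * \<tau>) * Im (D s * cnj (D t))"
    by (simp add: V_def W_def algebra_simps)
  then have "Im (V * cnj W) \<noteq> 0" using transversal sign by auto
  then obtain c where "c > 0" and c: "\<And>x y. cmod (x *\<^sub>R V + y *\<^sub>R W) \<ge> c * (\<bar>x\<bar> + \<bar>y\<bar>)"
    using norm_lin_comb_ge by blast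
  have c': "cmod (x *\<^sub>R W + y *\<^sub>R V) \<ge> c * (\<bar>x\<bar> + \<bar>y\<bar>)" for x y
    using c[of y x] by (simp add: add.commute)
  obtain d1 where "d1 > 0" and d1: "\<And>h. \<bar>h\<bar> < d1 \<Longrightarrow> cmod (\<Gamma> (s + h) - \<Gamma> s - h *\<^sub>R D s) \<le> c/4 * \<bar>h\<bar>"
    using has_vector_derivative_remainder_bound[OF deriv[of s], of "c/4"] \<open>c > 0\<close> by auto
  obtain d2 where "d2 > 0" and d2: "\<And>h. \<bar>h\<bar> < d2 \<Longrightarrow> cmod (\<Gamma> (t + h) - \<Gamma> t - h *\<^sub>R D t) \<le> c/4 * \<bar>h\<bar>"
    using has_vector_derivative_remainder_bound[OF deriv[of t], of "c/4"] \<open>c > 0\<close> by auto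
  define \<delta> where "\<delta> = min d (min d1 d2)"
  have \<delta>: "\<delta> > 0" using \<open>d > 0\<close> \<open>d1 > 0\<close> \<open>d2 > 0\<close> by (simp add: \<delta>_def)
  have cont: "isCont \<Gamma> u" for u using has_vector_derivative_continuous[OF deriv] .
  \<comment> \<open>The rest of \<open>K\<close> has a compact image that misses \<open>p\<close>,
    hence stays outside a ball around \<open>p\<close>. A segment inside this ball can meet only the
    two half-branches.\<close>
  define K' where "K' = K - ball s \<delta> - ball t \<delta>"
  have "compact K'" unfolding K'_def using \<open>compact K\<close> by (intro compact_diff) auto
  then have "compact (\<Gamma> ` K')"
    using cont by (intro compact_continuous_image) (auto intro: continuous_at_imp_continuous_on)
  moreover have "p \<notin> \<Gamma> ` K'"
    using only \<delta> by (force simp: K'_def p_def)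
  ultimately obtain \<rho> where "\<rho> > 0" and \<rho>: "ball p \<rho> \<subseteq> - \<Gamma> ` K'"
    using open_contains_ball[of "- \<Gamma> ` K'"] by (metis ComplI compact_imp_closed open_Compl)
  have lim: "((\<lambda>e. \<Gamma> (s - \<sigma> * e)) \<longlongrightarrow> p) (at_right 0)" "((\<lambda>e. \<Gamma> (t - \<tau> * e)) \<longlongrightarrow> p) (at_right 0)"
    unfolding p_def by (rule isCont_tendsto_compose[OF cont], auto intro!: tendsto_eq_intros)
      (subst meet, rule isCont_tendsto_compose[OF cont], auto intro!: tendsto_eq_intros)
  have "eventually (\<lambda>e. \<Gamma> (s - \<sigma> * e) \<in> ball p \<rho>) (at_right 0)" "eventually (\<lambda>e. \<Gamma> (t - \<tau> * e) \<in> ball p \<rho>) (at_right 0)"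
    using lim[THEN topological_tendstoD, of "ball p \<rho>"] \<open>\<rho> > 0\<close> by auto
  moreover have "eventually (\<lambda>e. e < \<delta>) (at_right 0)"
    using \<delta> by (intro order_tendstoD(2)[OF tendsto_ident_at]) auto
  moreover have "eventually (\<lambda>e::real. 0 < e) (at_right 0)"
    by (simp add: eventually_at_right_less)
  ultimately show ?thesis
  proof eventually_elim
    case (elim e)
    define r1 where "r1 = \<Gamma> (s - \<sigma> * e) - p + e *\<^sub>R V"
    define r2 where "r2 = \<Gamma> (t - \<tau> * e) - p + e *\<^sub>R W"
    have r1: "cmod r1 \<le> c/4 * e"
      using d1[of "- \<sigma> * e"] elim sign by (simp add: r1_def p_def V_def abs_mult \<delta>_def mult.commute)
    have r2: "cmod r2 \<le> c/4 * e"
      using d2[of "- \<tau> * e"] elim sign by (simp add: r2_def p_def meet W_def abs_mult \<delta>_def mult.commute)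
    have False if "q \<in> closed_segment (\<Gamma> (s - \<sigma> * e)) (\<Gamma> (t - \<tau> * e))" and u: "u \<in> K" "q = \<Gamma> u" for q u
    proof -
      obtain \<mu> where \<mu>: "0 \<le> \<mu>" "\<mu> \<le> 1"
        and q: "q = (1 - \<mu>) *\<^sub>R (p - e *\<^sub>R V + r1) + \<mu> *\<^sub>R (p - e *\<^sub>R W + r2)"
      proof -
        have "\<Gamma> (s - \<sigma> * e) = p - e *\<^sub>R V + r1" "\<Gamma> (t - \<tau> * e) = p - e *\<^sub>R W + r2"
          by (simp_all add: r1_def r2_def)
        then show thesis using that \<open>q \<in> closed_segment _ _\<close> by (auto simp: in_segment)
      qed
      have "q \<in> ball p \<rho>"
        using that(1) elim(1,2) closed_segment_subset[OF _ _ convex_ball] by blast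
      then have "u \<notin> K'" using u \<rho> by auto
      then consider "\<bar>u - s\<bar> < \<delta>" | "\<bar>u - t\<bar> < \<delta>"
        using u by (auto simp: K'_def dist_real_def abs_minus_commute)
      then show False
      proof cases
        case 1
        define h where "h = \<sigma> * (u - s)"
        have h: "0 \<le> h" "\<bar>u - s\<bar> = h" using side_s[of u] 1 u sign by (auto simp: h_def \<delta>_def abs_mult dest: abs_of_nonneg)
        define r where "r = \<Gamma> u - p - h *\<^sub>R V"
        have "h *\<^sub>R V = (u - s) *\<^sub>R D s"
          using \<sigma>\<tau> by (simp add: h_def V_def mult.assoc mult.left_commute[of _ \<sigma>] flip: mult.assoc[of \<sigma> \<sigma>])
        then have "cmod r \<le> c/4 * h"
          using d1[of "u - s"] 1 by (simp add: r_def p_def \<delta>_def h(2))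
        from sector_avoids[OF c \<open>c > 0\<close> h(1) elim(4) \<mu> this r1 r2, of p] show False
          using q u by (simp add: r_def)
      next
        case 2
        define h where "h = \<tau> * (u - t)"
        have h: "0 \<le> h" "\<bar>u - t\<bar> = h" using side_t[of u] 2 u sign by (auto simp: h_def \<delta>_def abs_mult dest: abs_of_nonneg)
        define r where "r = \<Gamma> u - p - h *\<^sub>R W"
        have "h *\<^sub>R W = (u - t) *\<^sub>R D t"
          using \<sigma>\<tau> by (simp add: h_def W_def mult.assoc mult.left_commute[of _ \<tau>] flip: mult.assoc[of \<tau> \<tau>])
        then have "cmod r \<le> c/4 * h"
          using d2[of "u - t"] 2 by (simp add: r_def p_def \<delta>_def h(2) meet)
        \<comment> \<open>The second branch is handled as the first, with \<open>V\<close> and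
          \<open>W\<close> exchanged and the segment traversed backwards.\<close>
        moreover have "0 \<le> 1 - \<mu>" "1 - \<mu> \<le> 1" using \<mu> by auto
        ultimately show False
          using sector_avoids[OF c' \<open>c > 0\<close> h(1) elim(4), of "1 - \<mu>" r r2 r1 p] r1 r2 q u by (simp add: r_def add.commute)
      qed
    qed
    then show ?case by blast
  qed
qed

section \<open>Loops carried by a generic curve\<close>

text \<open>\<open>Im (D s * cnj (D t))\<close> is, up to sign, the determinant of the two
  velocities. Finiteness of the set of double points will come from the finiteness of the chord
  diagram.\<close>

locale plane_curve =
  fixes g :: "complex \<Rightarrow> complex" and D :: "real \<Rightarrow> complex"
  assumes deriv: "((\<lambda>t. g (cis t)) has_vector_derivative D t) (at t)"
    and no_triple: "g (cis r) = g (cis s) \<Longrightarrow> g (cis s) = g (cis t) \<Longrightarrow>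
      cis r = cis s \<or> cis s = cis t \<or> cis r = cis t"
    and transversal: "cis s \<noteq> cis t \<Longrightarrow> g (cis s) = g (cis t) \<Longrightarrow> Im (D s * cnj (D t)) \<noteq> 0"
    and finite_double: "finite {cis t | t. \<exists>s. cis s \<noteq> cis t \<and> g (cis s) = g (cis t)}"
begin

definition \<Gamma> :: "real \<Rightarrow> complex" where "\<Gamma> t = g (cis t)"

lemma \<Gamma>_deriv: "(\<Gamma> has_vector_derivative D t) (at t)"
  using deriv[of t] by (simp add: \<Gamma>_def[abs_def])

lemma \<Gamma>_cont: "isCont \<Gamma> t"
  using has_vector_derivative_continuous[OF \<Gamma>_deriv] .

lemma \<Gamma>_periodic: "\<Gamma> (t + 2 * pi) = \<Gamma> t"
  by (simp add: \<Gamma>_def flip: cis_mult)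

lemma finite_crossings:
  assumes "I \<subseteq> {w..<w + 2 * pi}" and "\<And>v. v \<in> I \<Longrightarrow> cis v \<notin> cis ` K"
  shows "finite {v \<in> I. \<Gamma> v \<in> \<Gamma> ` K}"
proof (rule finite_imageD)
  show "finite (cis ` {v \<in> I. \<Gamma> v \<in> \<Gamma> ` K})"
  proof (rule finite_subset[OF _ finite_double], clarify)
    fix v u assume "v \<in> I" "u \<in> K" "\<Gamma> v = \<Gamma> u"
    then show "\<exists>t. cis v = cis t \<and> (\<exists>s. cis s \<noteq> cis t \<and> g (cis s) = g (cis t))"
      using assms(2)[of v] by (metis \<Gamma>_def imageI)
  qed
  show "inj_on cis {v \<in> I. \<Gamma> v \<in> \<Gamma> ` K}"
    by (rule inj_on_subset[OF inj_on_cis]) (use assms(1) in auto)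
qed

end

text \<open>
  The loop follows the curve from \<open>a\<close> to \<open>b\<close>, jumps to \<open>b'\<close> and follows the curve backwards to
  \<open>a'\<close>. The choice \<open>a' = b' = a\<close> gives the loop cut off by a single chord.
\<close>
locale loop_in_curve = plane_curve +
  fixes a b a' b' :: real
  assumes ab: "a < b" "a' \<le> b'" "\<Gamma> a = \<Gamma> a'" "\<Gamma> b = \<Gamma> b'"
    and window: "{a..b} \<union> {a'..b'} \<subseteq> {a..<a + 2 * pi}"
    and overlap: "{a..b} \<inter> {a'..b'} \<subseteq> {a}"
    and corners: "p \<in> {a, b, a', b'} \<Longrightarrow> \<exists>q\<in>{a..b} \<union> {a'..b'}. q \<noteq> p \<and> \<Gamma> q = \<Gamma> p"
begin

definition arcs :: "real set" where "arcs = {a..b} \<union> {a'..b'}"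

definition loop :: "real \<Rightarrow> complex" where "loop = subpath a b \<Gamma> +++ subpath b' a' \<Gamma>"

lemma cis_eq_arcs: "u \<in> arcs \<Longrightarrow> u' \<in> arcs \<Longrightarrow> cis u = cis u' \<Longrightarrow> u = u'"
  using window inj_on_cis[of a] unfolding arcs_def inj_on_def by blast

lemma compact_arcs: "compact arcs"
  unfolding arcs_def by (intro compact_Un) auto

lemma path_loop: "path loop" and loop_closed: "pathfinish loop = pathstart loop"
  and path_image_loop: "path_image loop = \<Gamma> ` arcs"
proof -
  have "continuous_on UNIV \<Gamma>"
    by (intro continuous_at_imp_continuous_on ballI \<Gamma>_cont)
  then have "path (subpath c d \<Gamma>)" for c d
    unfolding path_def subpath_def by (rule continuous_on_compose2) (auto intro!: continuous_intros)
  then show "path loop" "pathfinish loop = pathstart loop" "path_image loop = \<Gamma> ` arcs"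
    using ab by (simp_all add: loop_def arcs_def path_image_join path_image_subpath image_Un)
qed

lemma even_winding_connected:
  assumes "connected S" "S \<inter> \<Gamma> ` arcs = {}" "p \<in> S" "q \<in> S"
  shows "even_winding loop p \<longleftrightarrow> even_winding loop q"
  using winding_number_eq[OF path_loop loop_closed assms(3,4,1)] assms(2)
  by (simp add: even_winding_def path_image_loop)

text \<open>The second curve of a pair may close up at a double point off the loop; the parities
  just before its two preimages are compared through their common value.\<close>

lemma even_winding_left_limit:
  assumes "\<Gamma> y \<notin> \<Gamma> ` arcs"
  shows "eventually (\<lambda>e. even_winding loop (\<Gamma> (y - e)) \<longleftrightarrow> even_winding loop (\<Gamma> y)) (at_right 0)"
proof -
  have "open (- \<Gamma> ` arcs)"
    using closed_path_image[OF path_loop] by (simp add: path_image_loop open_Compl)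
  then obtain \<rho> where "\<rho> > 0" and \<rho>: "ball (\<Gamma> y) \<rho> \<subseteq> - \<Gamma> ` arcs"
    using assms open_contains_ball by blast
  have "((\<lambda>e. \<Gamma> (y - e)) \<longlongrightarrow> \<Gamma> y) (at_right 0)"
    by (auto intro!: isCont_tendsto_compose[OF \<Gamma>_cont[of y]] tendsto_eq_intros)
  then have "eventually (\<lambda>e. \<Gamma> (y - e) \<in> ball (\<Gamma> y) \<rho>) (at_right 0)"
    using \<open>\<rho> > 0\<close> by (intro topological_tendstoD) auto
  then show ?thesis
  proof eventually_elim
    case (elim e)
    show ?case
      by (rule even_winding_connected[of "ball (\<Gamma> y) \<rho>"]) (use \<rho> elim \<open>\<rho> > 0\<close> in auto)
  qed
qed

text \<open>Both preimages of a corner lie in \<open>arcs\<close>, so an outside strand through a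
  corner would create a triple point. Every crossing is therefore interior to one smooth arc, and
  the absence of triple points makes its parameter unique.\<close>

lemma crossing_interior:
  assumes v: "cis v \<notin> cis ` arcs" "\<Gamma> v \<in> \<Gamma> ` arcs"
  obtains u where "u \<in> {a<..<b} - {a'..b'} \<or> u \<in> {a'<..<b'} - {a..b}" "\<Gamma> u = \<Gamma> v"
    "\<And>u'. u' \<in> arcs \<Longrightarrow> \<Gamma> u' = \<Gamma> v \<Longrightarrow> u' = u" "Im (D u * cnj (D v)) \<noteq> 0"
proof -
  obtain u where u: "u \<in> arcs" "\<Gamma> u = \<Gamma> v" using v(2) by auto
  have ne: "cis w \<noteq> cis v" if "w \<in> arcs" for w using v(1) that by (metis imageI)
  have uniq: "u' = u" if "u' \<in> arcs" "\<Gamma> u' = \<Gamma> v" for u'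
  proof -
    have "cis u' = cis u"
      using no_triple[of u' v u] ne[OF that(1)] ne[OF u(1)] u(2) that(2) unfolding \<Gamma>_def by metis
    then show ?thesis using cis_eq_arcs u that by blast
  qed
  have "u \<notin> {a, b, a', b'}"
    using corners uniq u unfolding arcs_def by metis
  then have "u \<in> {a<..<b} - {a'..b'} \<or> u \<in> {a'<..<b'} - {a..b}"
    using u(1) overlap by (auto simp: arcs_def)
  moreover have "Im (D u * cnj (D v)) \<noteq> 0"
    using transversal ne[OF u(1)] u(2) by (simp add: \<Gamma>_def)
  ultimately show thesis using that u(2) uniq by blast
qed

lemma closed_parity:
  assumes "x \<le> y" "\<Gamma> x \<notin> \<Gamma> ` arcs" "\<Gamma> y \<notin> \<Gamma> ` arcs"
    and fin: "finite {v \<in> {x..y}. \<Gamma> v \<in> \<Gamma> ` arcs}"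
    and disj: "\<And>v. v \<in> {x..y} \<Longrightarrow> cis v \<notin> cis ` arcs"
  shows "(even_winding loop (\<Gamma> x) \<longleftrightarrow> even_winding loop (\<Gamma> y))
    \<longleftrightarrow> even (card {v \<in> {x..y}. \<Gamma> v \<in> \<Gamma> ` arcs})"
proof (rule even_winding_parity[OF \<Gamma>_deriv ab arcs_def loop_def assms(1-3) refl fin])
  fix v assume "v \<in> {v \<in> {x..y}. \<Gamma> v \<in> \<Gamma> ` arcs}"
  then show "\<exists>u. (u \<in> {a<..<b} - {a'..b'} \<or> u \<in> {a'<..<b'} - {a..b}) \<and> \<Gamma> u = \<Gamma> v \<and>
      (\<forall>u'\<in>arcs. \<Gamma> u' = \<Gamma> v \<longrightarrow> u' = u) \<and> Im (D u * cnj (D v)) \<noteq> 0"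
    using crossing_interior[of v] disj[of v] by (metis (no_types, lifting) mem_Collect_eq)
qed

text \<open>The ends of the strand may be corners of the loop, where the parity is not meaningful.
  For small \<open>e\<close> the shortened strand contains the same crossings.\<close>

lemma open_parity:
  assumes "x < y" and fin: "finite {v \<in> {x<..<y}. \<Gamma> v \<in> \<Gamma> ` arcs}"
    and disj: "\<And>v. v \<in> {x<..<y} \<Longrightarrow> cis v \<notin> cis ` arcs"
  shows "eventually (\<lambda>e. (even_winding loop (\<Gamma> (x + e)) \<longleftrightarrow> even_winding loop (\<Gamma> (y - e)))
    \<longleftrightarrow> even (card {v \<in> {x<..<y}. \<Gamma> v \<in> \<Gamma> ` arcs})) (at_right 0)"
proof -
  let ?Z = "{v \<in> {x<..<y}. \<Gamma> v \<in> \<Gamma> ` arcs}"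
  have small: "eventually (\<lambda>e::real. e < r) (at_right 0)" if "r > 0" for r
    using that by (intro order_tendstoD(2)[OF tendsto_ident_at]) auto
  have "eventually (\<lambda>e. \<forall>v\<in>?Z. e < min (v - x) (y - v)) (at_right 0)"
    by (rule eventually_ball_finite[OF fin]) (auto intro!: small simp del: min_less_iff_conj)
  moreover have "eventually (\<lambda>e. e < (y - x) / 2) (at_right 0)"
    using assms(1) by (intro small) simp
  moreover have "eventually (\<lambda>e::real. 0 < e) (at_right 0)"
    by (simp add: eventually_at_right_less)
  ultimately show ?thesis
  proof eventually_elim
    case (elim e)
    have eq: "{v \<in> {x + e..y - e}. \<Gamma> v \<in> \<Gamma> ` arcs} = ?Z"
      using elim by force
    have "x + e \<notin> ?Z" "y - e \<notin> ?Z"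
      using elim(1) by force+
    then have "\<Gamma> (x + e) \<notin> \<Gamma> ` arcs" "\<Gamma> (y - e) \<notin> \<Gamma> ` arcs"
      using elim(2,3) by auto
    then show ?case
      using closed_parity[of "x + e" "y - e"] elim(2,3) fin disj unfolding eq by auto
  qed
qed

lemma double_point_off_loop:
  assumes "\<Gamma> c = \<Gamma> d" "cis c \<noteq> cis d" "cis c \<notin> cis ` arcs" "cis d \<notin> cis ` arcs"
  shows "\<Gamma> c \<notin> \<Gamma> ` arcs"
proof
  assume "\<Gamma> c \<in> \<Gamma> ` arcs"
  then obtain u where "u \<in> arcs" "\<Gamma> c = \<Gamma> u" by auto
  then show False
    using assms no_triple[of c d u] by (metis \<Gamma>_def imageI)
qed

end

section \<open>Even intersection numbers of pairs of closed curves\<close>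

context plane_curve
begin

lemma loop_of_chord:
  assumes "s < t" "t < s + 2 * pi" "\<Gamma> s = \<Gamma> t"
  shows "loop_in_curve g D s t s s"
    and "loop_in_curve.arcs s t s s = {s..t}"
proof -
  show "loop_in_curve g D s t s s"
    by unfold_locales (use assms in \<open>auto intro: bexI[of _ s] bexI[of _ t]\<close>)
  then show "loop_in_curve.arcs s t s s = {s..t}"
    using assms by (simp add: loop_in_curve.arcs_def insert_absorb)
qed

text \<open>The strand from \<open>c\<close> to \<open>d\<close> is closed and starts off the loop,
  so the parity returns to its initial value.\<close>

lemma even_crossings_disjoint:
  assumes "a < b" "b < c" "c < d" "d < a + 2 * pi" and eq: "\<Gamma> a = \<Gamma> b" "\<Gamma> c = \<Gamma> d"
  shows "even (card {v \<in> {c..d}. \<Gamma> v \<in> \<Gamma> ` {a..b}})"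
proof -
  have "b < a + 2 * pi" using assms by simp
  note L = loop_of_chord[OF assms(1) this eq(1)]
  interpret loop_in_curve g D a b a a by (rule L(1))
  have cis_eq: "u = v" if "u \<in> {a..d}" "v \<in> {a..d}" "cis u = cis v" for u v
    using inj_onD[OF inj_on_cis[of a] that(3)] that assms by auto
  have disj: "cis v \<notin> cis ` arcs" if "v \<in> {c..d}" for v
    unfolding L(2) using cis_eq[of v] that assms by force
  have "cis c \<noteq> cis d" using cis_eq[of c d] assms by auto
  then have off: "\<Gamma> c \<notin> \<Gamma> ` arcs"
    using eq(2) disj[of c] disj[of d] \<open>c < d\<close> by (intro double_point_off_loop[of c d]) auto
  have "finite {v \<in> {c..d}. \<Gamma> v \<in> \<Gamma> ` arcs}"
    using assms disj by (intro finite_crossings[of _ a]) auto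
  then show ?thesis
    using closed_parity[of c d] off eq(2) disj assms unfolding L(2) by auto
qed

text \<open>The complementary strand leaves the corner after \<open>t\<close> and returns to it
  before \<open>s + 2 * pi\<close>. These half-branches bound a sector free of the loop near the
  corner, so the parity is the same at both ends.\<close>

lemma even_crossings_self:
  assumes "s < t" "t < s + 2 * pi" and eq: "\<Gamma> s = \<Gamma> t"
  shows "even (card {v \<in> {t<..<s + 2 * pi}. \<Gamma> v \<in> \<Gamma> ` {s..t}})"
proof -
  note L = loop_of_chord[OF assms]
  interpret loop_in_curve g D s t s s by (rule L(1))
  have cis_eq: "u = v" if "u \<in> {s..<s + 2 * pi}" "v \<in> {s..<s + 2 * pi}" "cis u = cis v" for u v
    using inj_onD[OF inj_on_cis[of s] that(3)] that by auto
  have disj: "cis v \<notin> cis ` arcs" if "v \<in> {t<..<s + 2 * pi}" for v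
    unfolding L(2) using cis_eq[of v] that assms by force
  have "cis s \<noteq> cis t" using cis_eq[of s t] assms by auto
  have only: "u = s \<or> u = t" if "u \<in> {s..t}" "\<Gamma> u = \<Gamma> s" for u
  proof -
    have "cis u = cis s \<or> cis u = cis t"
      using no_triple[of u s t] \<open>cis s \<noteq> cis t\<close> eq that(2) unfolding \<Gamma>_def by metis
    then show ?thesis using cis_eq[of u s] cis_eq[of u t] that(1) assms by auto
  qed
  \<comment> \<open>The loop lies to the right of \<open>s\<close> and to the left of
    \<open>t\<close>, whence the signs 1 and -1.\<close>
  have "eventually (\<lambda>e. closed_segment (\<Gamma> (s - 1 * e)) (\<Gamma> (t - (-1) * e)) \<inter> \<Gamma> ` {s..t} = {}) (at_right 0)"
    by (rule eventually_segment_avoids_corner[OF \<Gamma>_deriv eq, of 1 "-1" _ "t - s"])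
      (use only \<open>s < t\<close> transversal[OF \<open>cis s \<noteq> cis t\<close>] eq in \<open>auto simp: \<Gamma>_def\<close>)
  then have "eventually (\<lambda>e. closed_segment (\<Gamma> (s - e)) (\<Gamma> (t + e)) \<inter> \<Gamma> ` {s..t} = {}) (at_right 0)"
    by simp
  moreover have "eventually (\<lambda>e. (even_winding loop (\<Gamma> (t + e)) \<longleftrightarrow> even_winding loop (\<Gamma> (s + 2 * pi - e)))
    \<longleftrightarrow> even (card {v \<in> {t<..<s + 2 * pi}. \<Gamma> v \<in> \<Gamma> ` arcs})) (at_right 0)"
    using disj assms by (intro open_parity finite_crossings[of _ s]) auto
  ultimately have "eventually (\<lambda>e::real. even (card {v \<in> {t<..<s + 2 * pi}. \<Gamma> v \<in> \<Gamma> ` arcs})) (at_right 0)"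
  proof eventually_elim
    case (elim e)
    have "even_winding loop (\<Gamma> (s - e)) \<longleftrightarrow> even_winding loop (\<Gamma> (t + e))"
      by (rule even_winding_connected[OF _ elim(1)[folded L(2)]]) auto
    then show ?case using elim(2) \<Gamma>_periodic[of "s - e"] by (simp add: algebra_simps)
  qed
  then show ?thesis by (simp add: L(2))
qed

text \<open>
  The loop runs through \<open>[a, b]\<close> and \<open>[a', b']\<close>, the other closed curve through \<open>[b, c]\<close> and
  \<open>[b', c']\<close>. They share the corner at the double point \<open>b\<close>, where they touch without crossing.
\<close>
lemma even_crossings_opposite:
  assumes ord: "a < b" "b < c" "c < a'" "a' < b'" "b' < c'" "c' < a + 2 * pi"
    and eq: "\<Gamma> a = \<Gamma> a'" "\<Gamma> b = \<Gamma> b'" "\<Gamma> c = \<Gamma> c'"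
  shows "even (card {v \<in> {b<..<c} \<union> {b'<..<c'}. \<Gamma> v \<in> \<Gamma> ` ({a..b} \<union> {a'..b'})})"
proof -
  interpret loop_in_curve g D a b a' b'
    by unfold_locales (use assms in \<open>auto intro: bexI[of _ a] bexI[of _ b] bexI[of _ a'] bexI[of _ b']\<close>)
  have cis_eq: "u = v" if "u \<in> {a..c'}" "v \<in> {a..c'}" "cis u = cis v" for u v
    using inj_onD[OF inj_on_cis[of a] that(3)] that assms by auto
  have disj: "cis v \<notin> cis ` arcs" if "v \<in> {b<..c} \<union> {b'<..c'}" for v
  proof
    assume "cis v \<in> cis ` arcs"
    then obtain u where "u \<in> arcs" "cis v = cis u" by auto
    then show False using cis_eq[of u v] that ord by (auto simp: arcs_def)
  qed
  have ne: "cis b \<noteq> cis b'" "cis c \<noteq> cis c'" using cis_eq[of b b'] cis_eq[of c c'] ord by auto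
  have only: "u = b \<or> u = b'" if "u \<in> arcs" "\<Gamma> u = \<Gamma> b" for u
  proof -
    have "cis u = cis b \<or> cis u = cis b'"
      using no_triple[of u b b'] ne(1) eq(2) that(2) unfolding \<Gamma>_def by metis
    then show ?thesis using cis_eq[of u b] cis_eq[of u b'] that(1) ord by (auto simp: arcs_def)
  qed
  have off: "\<Gamma> c \<notin> \<Gamma> ` arcs" "\<Gamma> c' \<notin> \<Gamma> ` arcs"
    using double_point_off_loop[of c c'] disj[of c] disj[of c'] ne eq ord by auto
  have fin: "finite {v \<in> {b<..<c}. \<Gamma> v \<in> \<Gamma> ` arcs}" "finite {v \<in> {b'<..<c'}. \<Gamma> v \<in> \<Gamma> ` arcs}"
    using disj ord by (intro finite_crossings[of _ a]; auto)+
  \<comment> \<open>Both arcs reach the corner from the left, whence the signs -1. The distance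
    \<open>a' - b\<close> keeps the arc that starts at \<open>a'\<close> out of the neighbourhood of
    \<open>b\<close>.\<close>
  have "eventually (\<lambda>e. closed_segment (\<Gamma> (b - (-1) * e)) (\<Gamma> (b' - (-1) * e)) \<inter> \<Gamma> ` arcs = {}) (at_right 0)"
    by (rule eventually_segment_avoids_corner[OF \<Gamma>_deriv eq(2), of "-1" "-1" _ "a' - b"])
      (use only ord transversal[OF ne(1)] eq compact_arcs in \<open>auto simp: \<Gamma>_def arcs_def\<close>)
  then have "eventually (\<lambda>e. closed_segment (\<Gamma> (b + e)) (\<Gamma> (b' + e)) \<inter> \<Gamma> ` arcs = {}) (at_right 0)"
    by simp
  moreover have "eventually (\<lambda>e. (even_winding loop (\<Gamma> (b + e)) \<longleftrightarrow> even_winding loop (\<Gamma> (c - e)))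
    \<longleftrightarrow> even (card {v \<in> {b<..<c}. \<Gamma> v \<in> \<Gamma> ` arcs})) (at_right 0)"
    using disj ord by (intro open_parity fin) auto
  moreover have "eventually (\<lambda>e. (even_winding loop (\<Gamma> (b' + e)) \<longleftrightarrow> even_winding loop (\<Gamma> (c' - e)))
    \<longleftrightarrow> even (card {v \<in> {b'<..<c'}. \<Gamma> v \<in> \<Gamma> ` arcs})) (at_right 0)"
    using disj ord by (intro open_parity fin) auto
  \<comment> \<open>At the far end both strands tend to the same point off the loop, so they end
    with the same parity; the segment makes them start with the same parity. Hence the two crossing
    counts agree modulo 2.\<close>
  moreover note even_winding_left_limit[OF off(1)] even_winding_left_limit[OF off(2)]
  ultimately have "eventually (\<lambda>e::real. even (card {v \<in> {b<..<c}. \<Gamma> v \<in> \<Gamma> ` arcs}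
      + card {v \<in> {b'<..<c'}. \<Gamma> v \<in> \<Gamma> ` arcs})) (at_right 0)"
  proof eventually_elim
    case (elim e)
    have "even_winding loop (\<Gamma> (b + e)) \<longleftrightarrow> even_winding loop (\<Gamma> (b' + e))"
      by (rule even_winding_connected[OF _ elim(1)]) auto
    then show ?case using elim(2-) eq(3) by auto
  qed
  moreover have "{v \<in> {b<..<c} \<union> {b'<..<c'}. \<Gamma> v \<in> \<Gamma> ` arcs}
    = {v \<in> {b<..<c}. \<Gamma> v \<in> \<Gamma> ` arcs} \<union> {v \<in> {b'<..<c'}. \<Gamma> v \<in> \<Gamma> ` arcs}" by auto
  moreover have "{v \<in> {b<..<c}. \<Gamma> v \<in> \<Gamma> ` arcs} \<inter> {v \<in> {b'<..<c'}. \<Gamma> v \<in> \<Gamma> ` arcs} = {}"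
    using ord by auto
  ultimately show ?thesis
    using fin by (simp add: card_Un_disjoint arcs_def)
qed

end

subsection \<open>Chord combinatorics\<close>

lemma cis_in_window:
  assumes "z \<in> sphere 0 1"
  obtains t where "t \<in> {w..<w + 2 * pi}" "z = cis t"
proof -
  have z: "z = cis (Arg z)"
    using assms cis_Arg[of z] by (cases "z = 0") (auto simp: sgn_eq)
  define n where "n = \<lfloor>(Arg z - w) / (2 * pi)\<rfloor>"
  define t where "t = Arg z - 2 * pi * n"
  have "n \<le> (Arg z - w) / (2 * pi)" "(Arg z - w) / (2 * pi) < n + 1"
    unfolding n_def by linarith+
  then have "t \<in> {w..<w + 2 * pi}"
    by (auto simp: t_def field_simps)
  moreover have "cis (Arg z) = cis t"
    by (auto simp: cis_eq_iff_int t_def)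
  ultimately show thesis using that z by metis
qed

text \<open>The definition lets the four angles lie anywhere on the line; cutting the circle at
  \<open>w\<close> turns crossing into the interleaving of two real intervals.\<close>

lemma chords_cross_window:
  assumes "w \<le> s1" "s1 < t1" "t1 < w + 2 * pi" "w \<le> s2" "s2 < t2" "t2 < w + 2 * pi"
  shows "chords_cross {cis s1, cis t1} {cis s2, cis t2} \<longleftrightarrow>
    s1 < s2 \<and> s2 < t1 \<and> t1 < t2 \<or> s2 < s1 \<and> s1 < t2 \<and> t2 < t1"
proof
  assume "chords_cross {cis s1, cis t1} {cis s2, cis t2}"
  then obtain u1 u2 u3 u4 where u: "u1 < u2" "u2 < u3" "u3 < u4" "u4 < u1 + 2 * pi"
    and eq: "{cis s1, cis t1} = {cis u1, cis u3}" "{cis s2, cis t2} = {cis u2, cis u4}"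
    unfolding chords_cross_def by blast
  have lift: "\<exists>m::int. u = s + 2 * pi * m \<or> u = t + 2 * pi * m" if "cis u \<in> {cis s, cis t}" for u s t
    using that cis_eq_iff_int by auto
  obtain m :: int where m: "u1 = s1 + 2 * pi * m \<or> u1 = t1 + 2 * pi * m"
    using lift[of u1 s1 t1] eq by auto
  \<comment> \<open>Full turns are subtracted so that the first angle becomes \<open>s1\<close> or
    \<open>t1\<close>. The others then stay below \<open>w + 4 * pi\<close>, so each is an endpoint
    or its translate by one turn.\<close>
  define v where "v u = u - 2 * pi * m" for u
  have v_cis: "cis (v u) = cis u" for u
    by (auto simp: v_def cis_eq_iff_int intro: exI[of _ "-m"])
  have v1: "v u1 = s1 \<or> v u1 = t1" using m by (auto simp: v_def)
  have ord: "v u1 < v u2" "v u2 < v u3" "v u3 < v u4" "v u4 < v u1 + 2 * pi"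
    using u by (auto simp: v_def)
  have near: "y = x \<or> y = x + 2 * pi"
    if yx: "cis y = cis x" "w \<le> x" "x < w + 2 * pi" "w \<le> y" "y < w + 4 * pi" for x y
  proof -
    obtain n :: int where n: "y = x + 2 * pi * n" using yx(1) unfolding cis_eq_iff_int by blast
    then have "2 * pi * (-1) < 2 * pi * n" "2 * pi * n < 2 * pi * 2" using that n by linarith+
    then have "-1 < real_of_int n" "real_of_int n < 2" by (simp_all only: mult_less_cancel_left_pos pi_gt_zero mult_pos_pos zero_less_numeral)
    then have "n = 0 \<or> n = 1" by linarith
    then show ?thesis using n by auto
  qed
  have v3: "cis (v u3) \<in> {cis s1, cis t1}" and v2: "cis (v u2) \<in> {cis s2, cis t2}" and v4: "cis (v u4) \<in> {cis s2, cis t2}"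
    using eq v_cis by auto
  have ne: "cis (v u2) \<noteq> cis (v u4)" "cis (v u1) \<noteq> cis (v u3)"
  proof -
    have "inj_on cis {v u1..<v u1 + 2 * pi}" by (rule inj_on_cis)
    then show "cis (v u2) \<noteq> cis (v u4)" "cis (v u1) \<noteq> cis (v u3)"
      using ord by (auto dest!: inj_onD)
  qed
  have b3: "v u3 = s1 \<or> v u3 = s1 + 2 * pi \<or> v u3 = t1 \<or> v u3 = t1 + 2 * pi"
    using v3 near[of "v u3" s1] near[of "v u3" t1] ord v1 assms by auto
  have b2: "v u2 = s2 \<or> v u2 = s2 + 2 * pi \<or> v u2 = t2 \<or> v u2 = t2 + 2 * pi"
    using v2 near[of "v u2" s2] near[of "v u2" t2] ord v1 assms by auto
  have b4: "v u4 = s2 \<or> v u4 = s2 + 2 * pi \<or> v u4 = t2 \<or> v u4 = t2 + 2 * pi"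
    using v4 near[of "v u4" s2] near[of "v u4" t2] ord v1 assms by auto
  have c3: "v u1 = s1 \<and> v u3 = t1 \<or> v u1 = t1 \<and> v u3 = s1 + 2 * pi"
    using v1 b3 ord assms by (elim disjE) auto
  have c2: "v u2 \<noteq> v u4" "v u4 \<noteq> v u2 + 2 * pi" using ord by auto
  from c3 show "s1 < s2 \<and> s2 < t1 \<and> t1 < t2 \<or> s2 < s1 \<and> s1 < t2 \<and> t2 < t1"
  proof
    assume "v u1 = s1 \<and> v u3 = t1"
    then show ?thesis using b2 b4 c2 ord assms by (elim disjE) auto
  next
    assume "v u1 = t1 \<and> v u3 = s1 + 2 * pi"
    then show ?thesis using b2 b4 c2 ord assms by (elim disjE) auto
  qed
next
  have shift: "cis (s2 + 2 * pi) = cis s2"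
    by (auto simp: cis_eq_iff_int intro: exI[of _ 1])
  assume "s1 < s2 \<and> s2 < t1 \<and> t1 < t2 \<or> s2 < s1 \<and> s1 < t2 \<and> t2 < t1"
  then show "chords_cross {cis s1, cis t1} {cis s2, cis t2}"
  proof
    assume "s1 < s2 \<and> s2 < t1 \<and> t1 < t2"
    then show ?thesis unfolding chords_cross_def
      using assms by (intro exI[of _ s1] exI[of _ s2] exI[of _ t1] exI[of _ t2]) auto
  next
    \<comment> \<open>Read from \<open>s1\<close>, the endpoint \<open>s2\<close> comes last, one
      turn later.\<close>
    assume "s2 < s1 \<and> s1 < t2 \<and> t2 < t1"
    then show ?thesis unfolding chords_cross_def
      using assms shift
      by (intro exI[of _ s1] exI[of _ t2] exI[of _ t1] exI[of _ "s2 + 2 * pi"]) (auto simp: insert_commute)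
  qed
qed

lemma sum_of_bool_bit_eq_0:
  "even (card {k::'n::finite. P k}) \<Longrightarrow> (\<Sum>k\<in>UNIV. of_bool (P k) :: bit) = 0"
proof -
  assume "even (card {k::'n. P k})"
  then obtain m where "card {k::'n. P k} = 2 * m" by (elim evenE)
  then show ?thesis by (simp add: sum_of_bool_eq)
qed

section \<open>Counting chords between arcs\<close>

text \<open>\<open>d\<close> labels the chords of the curve itself, while \<open>cr\<close> will be
  crossing in the given diagram, a homeomorphic image. What is kept of it is that the order of
  endpoints in any window decides crossing.\<close>

locale labelled_diagram = plane_curve g D
  for g D +
  fixes d :: "'n::finite \<Rightarrow> complex set" and cr :: "'n \<Rightarrow> 'n \<Rightarrow> bool"
  assumes bij: "bij_betw d UNIV {{x, y} | x y. x \<in> sphere 0 1 \<and> y \<in> sphere 0 1 \<and> x \<noteq> y \<and> g x = g y}"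
    and disjoint: "i \<noteq> j \<Longrightarrow> d i \<inter> d j = {}"
    and cross: "\<And>w s1 t1 s2 t2. w \<le> s1 \<Longrightarrow> s1 < t1 \<Longrightarrow> t1 < w + 2 * pi \<Longrightarrow>
      w \<le> s2 \<Longrightarrow> s2 < t2 \<Longrightarrow> t2 < w + 2 * pi \<Longrightarrow> d i = {cis s1, cis t1} \<Longrightarrow> d j = {cis s2, cis t2} \<Longrightarrow>
      cr i j \<longleftrightarrow> s1 < s2 \<and> s2 < t1 \<and> t1 < t2 \<or> s2 < s1 \<and> s1 < t2 \<and> t2 < t1"
begin

definition joins :: "'n \<Rightarrow> complex set \<Rightarrow> complex set \<Rightarrow> bool" where
  "joins k X Y \<longleftrightarrow> (\<exists>x\<in>X. \<exists>y\<in>Y. d k = {x, y})"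

text \<open>Each crossing is sent to the chord of its double point. Exactly one end of that chord
  lies over \<open>B\<close>, and disjointness of the chords makes the chord at this end
  unique.\<close>

lemma card_joins:
  assumes B: "B \<subseteq> {w..<w + 2 * pi}" and disj: "\<And>v. v \<in> B \<Longrightarrow> cis v \<notin> cis ` A"
  shows "card {k. joins k (cis ` A) (cis ` B)} = card {v \<in> B. \<Gamma> v \<in> \<Gamma> ` A}"
proof -
  define F where "F v = (SOME k. \<exists>u\<in>A. d k = {cis u, cis v})" for v
  have F: "\<exists>u\<in>A. d (F v) = {cis u, cis v}" if v: "v \<in> B" "\<Gamma> v \<in> \<Gamma> ` A" for v
    unfolding F_def
  proof (rule someI_ex)
    obtain u where "u \<in> A" "\<Gamma> u = \<Gamma> v" using v(2) by (metis imageE)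
    moreover have "cis u \<noteq> cis v" using disj[OF that(1)] \<open>u \<in> A\<close> by (metis imageI)
    ultimately have "{cis u, cis v} \<in> range d"
      using bij_betw_imp_surj_on[OF bij] by (fastforce simp: \<Gamma>_def)
    then show "\<exists>k. \<exists>u\<in>A. d k = {cis u, cis v}" using \<open>u \<in> A\<close> by (metis imageE)
  qed
  have "bij_betw F {v \<in> B. \<Gamma> v \<in> \<Gamma> ` A} {k. joins k (cis ` A) (cis ` B)}"
    unfolding bij_betw_def
  proof
    show "inj_on F {v \<in> B. \<Gamma> v \<in> \<Gamma> ` A}"
    proof
      fix v v' assume v: "v \<in> {v \<in> B. \<Gamma> v \<in> \<Gamma> ` A}" "v' \<in> {v \<in> B. \<Gamma> v \<in> \<Gamma> ` A}" "F v = F v'"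
      then obtain u u' where "u \<in> A" "u' \<in> A" "{cis u, cis v} = {cis u', cis v'}"
        using F[of v] F[of v'] by auto
      then have "cis v = cis v'" using disj v by (metis (no_types, lifting) doubleton_eq_iff imageI mem_Collect_eq)
      then show "v = v'" using inj_onD[OF inj_on_cis] v B by blast
    qed
    show "F ` {v \<in> B. \<Gamma> v \<in> \<Gamma> ` A} = {k. joins k (cis ` A) (cis ` B)}"
    proof
      show "F ` {v \<in> B. \<Gamma> v \<in> \<Gamma> ` A} \<subseteq> {k. joins k (cis ` A) (cis ` B)}"
        using F by (fastforce simp: joins_def)
      show "{k. joins k (cis ` A) (cis ` B)} \<subseteq> F ` {v \<in> B. \<Gamma> v \<in> \<Gamma> ` A}"
      proof clarify
        fix k assume "joins k (cis ` A) (cis ` B)"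
        then obtain u v where uv: "u \<in> A" "v \<in> B" "d k = {cis u, cis v}"
          by (auto simp: joins_def)
        have ne: "cis u \<noteq> cis v" using disj uv by (metis imageI)
        have "d k \<in> {{x, y} | x y. x \<in> sphere 0 1 \<and> y \<in> sphere 0 1 \<and> x \<noteq> y \<and> g x = g y}"
          using bij_betwE[OF bij] by blast
        then obtain x y where "d k = {x, y}" "g x = g y" by blast
        then have \<Gamma>: "\<Gamma> v = \<Gamma> u" using uv by (auto simp: \<Gamma>_def doubleton_eq_iff)
        then obtain u' where "d (F v) = {cis u', cis v}" using F[of v] uv by auto
        then have "cis v \<in> d (F v) \<inter> d k" using uv by auto
        then have "F v = k" using disjoint[of "F v" k] by blast
        then show "k \<in> F ` {v \<in> B. \<Gamma> v \<in> \<Gamma> ` A}" using uv \<Gamma> by auto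
      qed
    qed
  qed
  then show ?thesis by (simp add: bij_betw_same_card)
qed

end

text \<open>Cutting the circle at \<open>w\<close> gives each chord a lower and an upper end, so
  that crossing and joining become statements about the order of the reals.\<close>

locale windowed_diagram = labelled_diagram g D d cr
  for g D and d :: "'n::finite \<Rightarrow> complex set" and cr +
  fixes w :: real and lo hi :: "'n \<Rightarrow> real"
  assumes bounds: "w \<le> lo k" "lo k < hi k" "hi k < w + 2 * pi"
    and ends: "d k = {cis (lo k), cis (hi k)}"
begin

lemma cr_iff: "cr i j \<longleftrightarrow> lo i < lo j \<and> lo j < hi i \<and> hi i < hi j \<or> lo j < lo i \<and> lo i < hi j \<and> hi j < hi i"
  by (rule cross[of w]) (use bounds ends in auto)

lemma distinct_ends:
  assumes "k \<noteq> l"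
  shows "lo k \<noteq> lo l" "lo k \<noteq> hi l" "hi k \<noteq> lo l" "hi k \<noteq> hi l"
  using disjoint[OF assms] ends[of k] ends[of l] by auto

lemma \<Gamma>_ends: "\<Gamma> (lo k) = \<Gamma> (hi k)"
proof -
  have "d k \<in> {{x, y} | x y. x \<in> sphere 0 1 \<and> y \<in> sphere 0 1 \<and> x \<noteq> y \<and> g x = g y}"
    using bij_betwE[OF bij] by blast
  then obtain x y where "d k = {x, y}" "g x = g y" by blast
  then show ?thesis using ends[of k] by (auto simp: \<Gamma>_def doubleton_eq_iff)
qed

lemma joins_iff:
  assumes "A \<subseteq> {w..<w + 2 * pi}" "B \<subseteq> {w..<w + 2 * pi}"
  shows "joins k (cis ` A) (cis ` B) \<longleftrightarrow> lo k \<in> A \<and> hi k \<in> B \<or> hi k \<in> A \<and> lo k \<in> B"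
proof -
  have mem: "cis t \<in> cis ` C \<longleftrightarrow> t \<in> C" if "t \<in> {w..<w + 2 * pi}" "C \<subseteq> {w..<w + 2 * pi}" for t C
    using inj_on_image_mem_iff[OF inj_on_cis that] .
  have "joins k (cis ` A) (cis ` B) \<longleftrightarrow>
      cis (lo k) \<in> cis ` A \<and> cis (hi k) \<in> cis ` B \<or> cis (hi k) \<in> cis ` A \<and> cis (lo k) \<in> cis ` B"
    unfolding joins_def ends[of k] by (auto simp: doubleton_eq_iff)
  moreover have "lo k \<in> {w..<w + 2 * pi}" "hi k \<in> {w..<w + 2 * pi}"
    using bounds[of k] by auto
  ultimately show ?thesis using mem assms by simp
qed

text \<open>The window \<open>w'\<close> may differ from \<open>w\<close>: loops running across the
  cut are counted from a later angle, while \<open>joins\<close> depends only on points of the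
  circle.\<close>

lemma even_card_joins:
  assumes "A \<subseteq> {w'..<w' + 2 * pi}" "B \<subseteq> {w'..<w' + 2 * pi}" "A \<inter> B = {}"
    and "even (card {v \<in> B. \<Gamma> v \<in> \<Gamma> ` A})"
  shows "even (card {k. joins k (cis ` A) (cis ` B)})"
proof -
  have "cis v \<notin> cis ` A" if "v \<in> B" for v
    using inj_on_image_mem_iff[OF inj_on_cis _ assms(1)] that assms(2,3) by blast
  then show ?thesis using card_joins[OF assms(2), of A] assms(4) by simp
qed

text \<open>A chord crosses \<open>i\<close> exactly when it joins the two arcs into which the ends
  of \<open>i\<close> divide the circle.\<close>

lemma even_cr_base:
  assumes "lo i = w"
  shows "even (card {k. cr i k})"
proof -
  let ?A = "{lo i..hi i}" and ?B = "{hi i<..<lo i + 2 * pi}"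
  have "even (card {k. joins k (cis ` ?A) (cis ` ?B)})"
    using bounds[of i] assms even_crossings_self[of "lo i" "hi i"] \<Gamma>_ends[of i]
    by (intro even_card_joins[of _ w]) auto
  moreover have "joins k (cis ` ?A) (cis ` ?B) \<longleftrightarrow> cr i k" for k
  proof -
    have "joins k (cis ` ?A) (cis ` ?B) \<longleftrightarrow> lo k \<in> ?A \<and> hi k \<in> ?B \<or> hi k \<in> ?A \<and> lo k \<in> ?B"
      using bounds[of i] assms by (intro joins_iff) auto
    also have "\<dots> \<longleftrightarrow> cr i k"
      using bounds[of i] bounds[of k] distinct_ends[of i k] assms unfolding cr_iff by (cases "i = k") auto
    finally show ?thesis .
  qed
  ultimately show ?thesis by simp
qed

text \<open>Two chords that do not cross cut off disjoint arcs, and a chord crosses both exactly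
  when it joins these arcs. If \<open>j\<close> is nested in \<open>i\<close>, the arc to take for
  \<open>i\<close> is the outer one, which runs up to the cut.\<close>

lemma even_cr_cr_base:
  assumes "lo i = w" "\<not> cr i j" "i \<noteq> j"
  shows "even (card {k. cr i k \<and> cr j k})"
proof (cases "hi i < lo j")
  case True
  let ?A = "{lo i..hi i}" and ?B = "{lo j..hi j}"
  have "even (card {k. joins k (cis ` ?A) (cis ` ?B)})"
    using bounds[of i] bounds[of j] True assms even_crossings_disjoint[of "lo i" "hi i" "lo j" "hi j"] \<Gamma>_ends
    by (intro even_card_joins[of _ w]) auto
  moreover have "joins k (cis ` ?A) (cis ` ?B) \<longleftrightarrow> cr i k \<and> cr j k" for k
  proof -
    have "joins k (cis ` ?A) (cis ` ?B) \<longleftrightarrow> lo k \<in> ?A \<and> hi k \<in> ?B \<or> hi k \<in> ?A \<and> lo k \<in> ?B"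
      using bounds[of i] bounds[of j] assms by (intro joins_iff) auto
    also have "\<dots> \<longleftrightarrow> cr i k \<and> cr j k"
      using bounds[of i] bounds[of j] bounds[of k] distinct_ends[of i k] distinct_ends[of j k] assms True
      unfolding cr_iff by (cases "i = k"; cases "j = k") auto
    finally show ?thesis .
  qed
  ultimately show ?thesis by simp
next
  case False
  then have nested: "w < lo j" "hi j < hi i"
    using bounds[of i] bounds[of j] distinct_ends[OF \<open>i \<noteq> j\<close>] assms(1,2) unfolding cr_iff by auto
  \<comment> \<open>\<open>?B\<close> is the outer arc as the curve traverses it, ending at
    \<open>w + 2 * pi\<close>; \<open>?B'\<close> covers the same points of the circle inside the
    window, where \<open>joins_iff\<close> applies.\<close>
  let ?A = "{lo j..hi j}" and ?B = "{hi i..w + 2 * pi}" and ?B' = "insert w {hi i..<w + 2 * pi}"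
  have "even (card {k. joins k (cis ` ?A) (cis ` ?B)})"
    using bounds[of i] bounds[of j] nested assms even_crossings_disjoint[of "lo j" "hi j" "hi i" "w + 2 * pi"]
      \<Gamma>_ends[of i] \<Gamma>_ends[of j] \<Gamma>_periodic[of w]
    by (intro even_card_joins[of _ "lo j"]) auto
  moreover have "joins k (cis ` ?A) (cis ` ?B) \<longleftrightarrow> cr i k \<and> cr j k" for k
  proof -
    have "?B = insert (w + 2 * pi) {hi i..<w + 2 * pi}" using bounds[of i] by auto
    moreover have "cis (w + 2 * pi) = cis w" by (simp flip: cis_mult)
    ultimately have "cis ` ?B = cis ` ?B'" by simp
    then have "joins k (cis ` ?A) (cis ` ?B) \<longleftrightarrow> joins k (cis ` ?A) (cis ` ?B')" by simp
    also have "\<dots> \<longleftrightarrow> lo k \<in> ?A \<and> hi k \<in> ?B' \<or> hi k \<in> ?A \<and> lo k \<in> ?B'"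
      using bounds[of i] bounds[of j] by (intro joins_iff) auto
    also have "\<dots> \<longleftrightarrow> cr i k \<and> cr j k"
    proof (cases "k = i \<or> k = j")
      case True
      then show ?thesis using bounds[of i] bounds[of j] nested assms(1) unfolding cr_iff by auto
    next
      case False
      define p q where "p = lo k" and "q = hi k"
      have pq: "w < p" "p < q" "q < w + 2 * pi"
        using False bounds[of k] distinct_ends(1)[of k i] assms(1) by (auto simp: p_def q_def)
      have "p \<notin> {lo j, hi j, hi i}" "q \<notin> {lo j, hi j, hi i}"
        using False distinct_ends[of k] by (auto simp: p_def q_def)
      then have p: "p < lo j \<or> lo j < p \<and> p < hi j \<or> hi j < p \<and> p < hi i \<or> hi i < p"
        and q: "q < lo j \<or> lo j < q \<and> q < hi j \<or> hi j < q \<and> q < hi i \<or> hi i < q"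
        by auto
      show ?thesis
        unfolding cr_iff p_def[symmetric] q_def[symmetric]
        using p q pq nested bounds[of i] bounds[of j] assms(1) by (elim disjE) simp_all
    qed
    finally show ?thesis .
  qed
  ultimately show ?thesis by simp
qed

end

context labelled_diagram
begin

lemma window_exists: "\<exists>lo hi. windowed_diagram g D d cr w lo hi"
proof -
  have "\<exists>s t. w \<le> s \<and> s < t \<and> t < w + 2 * pi \<and> d k = {cis s, cis t}" for k
  proof -
    have "d k \<in> {{x, y} | x y. x \<in> sphere 0 1 \<and> y \<in> sphere 0 1 \<and> x \<noteq> y \<and> g x = g y}"
      using bij_betwE[OF bij] by blast
    then obtain x y where xy: "d k = {x, y}" "x \<in> sphere 0 1" "y \<in> sphere 0 1" "x \<noteq> y" by blast
    obtain s where s: "s \<in> {w..<w + 2 * pi}" "x = cis s" using cis_in_window[OF xy(2)] .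
    obtain t where t: "t \<in> {w..<w + 2 * pi}" "y = cis t" using cis_in_window[OF xy(3)] .
    have "s \<noteq> t" using xy s t by auto
    then show ?thesis
    proof (cases "s < t")
      case True
      then show ?thesis using s t xy by auto
    next
      case False
      then have "t < s" using \<open>s \<noteq> t\<close> by simp
      then show ?thesis using s t xy by (metis atLeastLessThan_iff insert_commute)
    qed
  qed
  then obtain lo hi where "\<And>k. w \<le> lo k \<and> lo k < hi k \<and> hi k < w + 2 * pi \<and> d k = {cis (lo k), cis (hi k)}"
    by metis
  then have "windowed_diagram g D d cr w lo hi" by unfold_locales auto
  then show ?thesis by blast
qed

text \<open>Any window supplies an endpoint of \<open>i\<close>; cutting there makes it the least
  angle, hence \<open>lo i\<close>.\<close>

lemma window_at_chord:
  obtains w lo hi where "windowed_diagram g D d cr w lo hi" "lo i = w"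
proof -
  obtain lo0 hi0 where "windowed_diagram g D d cr 0 lo0 hi0" using window_exists by blast
  then have s: "cis (lo0 i) \<in> d i" using windowed_diagram.ends by fastforce
  define w where "w = lo0 i"
  obtain lo hi where W: "windowed_diagram g D d cr w lo hi" using window_exists by blast
  interpret windowed_diagram g D d cr w lo hi by (rule W)
  have "w \<in> {w..<w + 2 * pi}" "lo i \<in> {w..<w + 2 * pi}" "hi i \<in> {w..<w + 2 * pi}"
    using bounds[of i] by auto
  moreover have "cis w = cis (lo i) \<or> cis w = cis (hi i)"
    using s ends[of i] by (auto simp: w_def)
  ultimately have "w = lo i \<or> w = hi i" using inj_onD[OF inj_on_cis[of w]] by blast
  then have "lo i = w" using bounds[of i] by auto
  then show thesis using that W by blast
qed

lemma even_cr: "even (card {k. cr i k})"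
proof -
  obtain w lo hi where W: "windowed_diagram g D d cr w lo hi" "lo i = w" using window_at_chord .
  interpret windowed_diagram g D d cr w lo hi by (rule W)
  show ?thesis using even_cr_base[OF W(2)] .
qed

text \<open>The case \<open>i = j\<close> is kept: as no chord crosses itself, it yields (1) as a
  special case of (2).\<close>

lemma even_cr_cr:
  assumes "\<not> cr i j"
  shows "even (card {k. cr i k \<and> cr j k})"
proof (cases "i = j")
  case True
  then show ?thesis using even_cr by simp
next
  case False
  obtain w lo hi where W: "windowed_diagram g D d cr w lo hi" "lo i = w" using window_at_chord .
  interpret windowed_diagram g D d cr w lo hi by (rule W)
  show ?thesis using even_cr_cr_base[OF W(2) assms False] .
qed

end

section \<open>Three pairwise intersecting chords\<close>

context windowed_diagram
begin

text \<open>
  The endpoints of \<open>i, j, l\<close> cut the circle into six arcs, cyclically numbered 1 to 6. If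
  \<open>x p q\<close> counts the other chords between arcs \<open>p\<close> and \<open>q\<close>, the left-hand side of the claim is
  \<open>x 1 4 + x 2 5 + x 3 6\<close> plus all \<open>x p q\<close> with \<open>p\<close> and \<open>q\<close> of equal parity, plus 3. It is
  the sum of the parities of the rows of \<open>i, j, l\<close> and of the intersection numbers of the
  pairs among the loops made of the opposite arcs 1, 4 and 2, 5 and 3, 6.
\<close>
lemma triple_base:
  assumes base: "lo i = w" and cr: "cr i j" "cr i l" "cr j l" and "lo j < lo l"
  shows "(\<Sum>k\<in>UNIV. of_bool (cr i k \<and> cr j k) + of_bool (cr i k \<and> cr l k) + of_bool (cr j k \<and> cr l k)) = (1::bit)"
proof -
  define a b c a' b' c' where "a = lo i" and "b = lo j" and "c = lo l" and "a' = hi i" and "b' = hi j" and "c' = hi l"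
  note pts = this
  have w: "w = a" using base pts by simp
  have ord: "a < b" "b < c" "c < a'" "a' < b'" "b' < c'" "c' < a + 2 * pi"
    using cr \<open>lo j < lo l\<close> base bounds[of i] bounds[of j] bounds[of l] unfolding cr_iff pts by auto
  have \<Gamma>: "\<Gamma> a = \<Gamma> a'" "\<Gamma> b = \<Gamma> b'" "\<Gamma> c = \<Gamma> c'" "\<Gamma> (a + 2 * pi) = \<Gamma> a" "\<Gamma> (b + 2 * pi) = \<Gamma> b"
    using \<Gamma>_ends \<Gamma>_periodic by (simp_all add: pts)
  have neq: "i \<noteq> j" "i \<noteq> l" "j \<noteq> l" using ord by (auto simp: pts)
  \<comment> \<open>The \<open>A\<close> sets are the closed arcs 1, 4 and 2, 5 and 3, 6; each
    \<open>B\<close> set is the next pair of arcs without its ends, so that \<open>i\<close>,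
    \<open>j\<close>, \<open>l\<close> themselves join nothing. In \<open>A3\<close>, the point
    \<open>a\<close> stands for \<open>a + 2 * pi\<close>.\<close>
  define A1 B1 where "A1 = {a..b} \<union> {a'..b'}" and "B1 = {b<..<c} \<union> {b'<..<c'}"
  define A2 B2 where "A2 = {b..c} \<union> {b'..c'}" and "B2 = {c<..<a'} \<union> {c'<..<a + 2 * pi}"
  define A3 B3 where "A3 = {c..a'} \<union> {c'..<a + 2 * pi} \<union> {a}" and "B3 = {a'<..<b'} \<union> {a<..<b}"
  have J1: "even (card {k. joins k (cis ` A1) (cis ` B1)})"
    unfolding A1_def B1_def using ord \<Gamma> by (intro even_card_joins[of _ a] even_crossings_opposite) auto
  have J2: "even (card {k. joins k (cis ` A2) (cis ` B2)})"
    unfolding A2_def B2_def using ord \<Gamma> by (intro even_card_joins[of _ b] even_crossings_opposite) auto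
  \<comment> \<open>The configuration is read from \<open>c\<close>, so arc 1 and the end of arc 6
    appear one turn later; on the circle they are the same points.\<close>
  have J3: "even (card {k. joins k (cis ` A3) (cis ` B3)})"
  proof -
    have shift: "cis (t + 2 * pi) = cis t" for t by (simp flip: cis_mult)
    have "{c'..a + 2 * pi} = insert (a + 2 * pi) {c'..<a + 2 * pi}" using ord by auto
    then have "cis ` A3 = cis ` ({c..a'} \<union> {c'..a + 2 * pi})"
      by (simp add: A3_def image_Un shift)
    moreover have "{a + 2 * pi<..<b + 2 * pi} = (\<lambda>t. t + 2 * pi) ` {a<..<b}"
    proof
      show "{a + 2 * pi<..<b + 2 * pi} \<subseteq> (\<lambda>t. t + 2 * pi) ` {a<..<b}"
      proof
        fix t assume "t \<in> {a + 2 * pi<..<b + 2 * pi}"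
        then show "t \<in> (\<lambda>t. t + 2 * pi) ` {a<..<b}"
          by (intro image_eqI[of _ _ "t - 2 * pi"]) auto
      qed
    qed auto
    then have "cis ` {a + 2 * pi<..<b + 2 * pi} = cis ` {a<..<b}"
      by (simp add: image_image shift)
    then have "cis ` B3 = cis ` ({a'<..<b'} \<union> {a + 2 * pi<..<b + 2 * pi})"
      by (simp add: B3_def image_Un)
    moreover have "even (card {k. joins k (cis ` ({c..a'} \<union> {c'..a + 2 * pi})) (cis ` ({a'<..<b'} \<union> {a + 2 * pi<..<b + 2 * pi}))})"
      using ord \<Gamma> by (intro even_card_joins[of _ c] even_crossings_opposite) auto
    ultimately show ?thesis by simp
  qed
  have J_iff:
    "joins k (cis ` A1) (cis ` B1) \<longleftrightarrow> lo k \<in> A1 \<and> hi k \<in> B1 \<or> hi k \<in> A1 \<and> lo k \<in> B1"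
    "joins k (cis ` A2) (cis ` B2) \<longleftrightarrow> lo k \<in> A2 \<and> hi k \<in> B2 \<or> hi k \<in> A2 \<and> lo k \<in> B2"
    "joins k (cis ` A3) (cis ` B3) \<longleftrightarrow> lo k \<in> A3 \<and> hi k \<in> B3 \<or> hi k \<in> A3 \<and> lo k \<in> B3" for k
    using ord w by (intro joins_iff; auto simp: A1_def B1_def A2_def B2_def A3_def B3_def)+
  have cr_pts: "cr i k \<longleftrightarrow> a < lo k \<and> lo k < a' \<and> a' < hi k \<or> lo k < a \<and> a < hi k \<and> hi k < a'"
    "cr j k \<longleftrightarrow> b < lo k \<and> lo k < b' \<and> b' < hi k \<or> lo k < b \<and> b < hi k \<and> hi k < b'"
    "cr l k \<longleftrightarrow> c < lo k \<and> lo k < c' \<and> c' < hi k \<or> lo k < c \<and> c < hi k \<and> hi k < c'" for k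
    unfolding cr_iff by (simp_all add: pts)
  \<comment> \<open>Another chord \<open>k\<close> crosses none of \<open>i\<close>,
    \<open>j\<close>, \<open>l\<close> if its ends lie in one arc, all three if in opposite arcs,
    and otherwise one or two; in this last case exactly one of the three \<open>joins\<close> holds.
    If it crosses \<open>n\<close> of them, the left side is \<open>n\<close> choose 2, congruent to
    \<open>n\<close> for 0 and 3 but not for 1 and 2. For \<open>k\<close> among \<open>i\<close>,
    \<open>j\<close>, \<open>l\<close> the left side is 1, two chords are crossed and nothing is
    joined, which the last summands correct.\<close>
  have pointwise: "of_bool (cr i k \<and> cr j k) + of_bool (cr i k \<and> cr l k) + of_bool (cr j k \<and> cr l k)
      = of_bool (cr i k) + of_bool (cr j k) + of_bool (cr l k) + of_bool (joins k (cis ` A1) (cis ` B1))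
      + of_bool (joins k (cis ` A2) (cis ` B2)) + of_bool (joins k (cis ` A3) (cis ` B3))
      + (of_bool (k = i) + of_bool (k = j) + of_bool (k = l) :: bit)" for k
  proof (cases "k \<in> {i, j, l}")
    case True
    then consider "k = i" "lo k = a" "hi k = a'" | "k = j" "lo k = b" "hi k = b'" | "k = l" "lo k = c" "hi k = c'"
      by (auto simp: pts)
    then show ?thesis
      unfolding J_iff cr_pts unfolding A1_def B1_def A2_def B2_def A3_def B3_def
      by cases (use ord neq in simp_all)
  next
    case False
    define p q where "p = lo k" and "q = hi k"
    have pq: "a < p" "p < q" "q < a + 2 * pi"
      using False bounds[of k] distinct_ends(1)[of k i] base unfolding p_def q_def pts by auto
    have "p \<noteq> b" "p \<noteq> c" "p \<noteq> a'" "p \<noteq> b'" "p \<noteq> c'" "q \<noteq> b" "q \<noteq> c" "q \<noteq> a'" "q \<noteq> b'" "q \<noteq> c'"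
      using False distinct_ends[of k] unfolding p_def q_def pts by auto
    then have p: "p < b \<or> b < p \<and> p < c \<or> c < p \<and> p < a' \<or> a' < p \<and> p < b' \<or> b' < p \<and> p < c' \<or> c' < p"
      and q: "q < b \<or> b < q \<and> q < c \<or> c < q \<and> q < a' \<or> a' < q \<and> q < b' \<or> b' < q \<and> q < c' \<or> c' < q"
      unfolding neq_iff by blast+
    have "k \<noteq> i" "k \<noteq> j" "k \<noteq> l" using False by auto
    then show ?thesis
      unfolding J_iff cr_pts unfolding A1_def B1_def A2_def B2_def A3_def B3_def p_def[symmetric] q_def[symmetric]
      using ord pq p q by (elim disjE) simp_all
  qed
  have "(\<Sum>k\<in>UNIV. of_bool (k = x)) = (1::bit)" for x :: 'n
    by (simp add: of_bool_def)
  then show ?thesis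
    unfolding pointwise sum.distrib
    using sum_of_bool_bit_eq_0[OF J1] sum_of_bool_bit_eq_0[OF J2] sum_of_bool_bit_eq_0[OF J3]
      sum_of_bool_bit_eq_0[OF even_cr] by simp
qed

end

lemma (in labelled_diagram) cr_irrefl: "\<not> cr i i"
proof -
  obtain w lo hi where W: "windowed_diagram g D d cr w lo hi" "lo i = w" using window_at_chord .
  interpret windowed_diagram g D d cr w lo hi by (rule W)
  show ?thesis by (simp add: cr_iff)
qed

text \<open>The claim is symmetric in \<open>j\<close> and \<open>l\<close>, so their lower ends may
  be put in order.\<close>

lemma (in labelled_diagram) triple:
  assumes "cr i j" "cr i l" "cr j l"
  shows "(\<Sum>k\<in>UNIV. of_bool (cr i k \<and> cr j k)) + (\<Sum>k\<in>UNIV. of_bool (cr i k \<and> cr l k))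
    + (\<Sum>k\<in>UNIV. of_bool (cr j k \<and> cr l k)) = (1::bit)"
proof -
  obtain w lo hi where W: "windowed_diagram g D d cr w lo hi" "lo i = w" using window_at_chord .
  interpret windowed_diagram g D d cr w lo hi by (rule W)
  have "j \<noteq> l" "cr l j" using assms(3) by (auto simp: cr_iff)
  then consider "lo j < lo l" | "lo l < lo j" using distinct_ends(1)[of j l] by linarith
  then show ?thesis
  proof cases
    case 1
    then show ?thesis using triple_base[OF W(2) assms] by (simp only: sum.distrib)
  next
    case 2
    then show ?thesis using triple_base[OF W(2) assms(2,1) \<open>cr l j\<close>]
      by (simp only: sum.distrib conj_commute add_ac)
  qed
qed

subsection \<open>Realizable Gauss diagrams\<close>

definition complex_of_vec :: "real ^ 2 \<Rightarrow> complex" where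
  "complex_of_vec x = Complex (x $ 1) (x $ 2)"

lemma bounded_linear_complex_of_vec: "bounded_linear complex_of_vec"
  unfolding linear_conv_bounded_linear[symmetric]
  by (rule linearI) (auto simp: complex_of_vec_def complex_eq_iff)

lemma complex_of_vec_eq_iff [simp]: "complex_of_vec x = complex_of_vec y \<longleftrightarrow> x = y"
  by (auto simp: complex_of_vec_def vec_eq_iff forall_2)

text \<open>If the determinant vanishes, a quarter turn of a nonzero one of the two vectors is
  orthogonal to both, hence to the whole plane and to itself.\<close>

lemma complex_of_vec_spanning:
  assumes "span {x, y :: real ^ 2} = UNIV"
  shows "Im (complex_of_vec x * cnj (complex_of_vec y)) \<noteq> 0"
proof
  assume "Im (complex_of_vec x * cnj (complex_of_vec y)) = 0"
  then have det: "x $ 2 * y $ 1 = x $ 1 * y $ 2"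
    by (simp add: complex_of_vec_def)
  obtain u :: "real ^ 2" where u: "u \<noteq> 0" "x \<bullet> u = 0" "y \<bullet> u = 0"
  proof (cases "x = 0")
    case False
    then show thesis using det
      by (intro that[of "vector [- x $ 2, x $ 1]"])
        (auto simp: inner_vec_def sum_2 vec_eq_iff forall_2 algebra_simps)
  next
    case True
    show thesis
    proof (cases "y = 0")
      case False
      then show thesis using True
        by (intro that[of "vector [- y $ 2, y $ 1]"])
          (auto simp: inner_vec_def sum_2 vec_eq_iff forall_2 algebra_simps)
    next
      case y: True
      show thesis
        by (rule that[of "axis 1 1"]) (use True y in \<open>auto simp: axis_eq_0_iff\<close>)
    qed
  qed
  have "orthogonal u u"
    using u assms by (intro orthogonal_to_span[of u "{x, y}"]) (auto simp: orthogonal_def inner_commute)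
  then show False using u by (simp add: orthogonal_self)
qed

lemma circle_op_homeo_inj_on:
  assumes "strict_mono \<phi>" "\<And>t. \<phi> (t + 2 * pi) = \<phi> t + 2 * pi" "\<And>t. h (cis t) = cis (\<phi> t)"
  shows "inj_on h (sphere 0 1)"
proof
  fix x y :: complex assume xy: "x \<in> sphere 0 1" "y \<in> sphere 0 1" "h x = h y"
  obtain s where s: "s \<in> {0..<0 + 2 * pi}" "x = cis s" using cis_in_window[OF xy(1)] .
  obtain t where t: "t \<in> {0..<0 + 2 * pi}" "y = cis t" using cis_in_window[OF xy(2)] .
  have mem: "\<phi> u \<in> {\<phi> 0..<\<phi> 0 + 2 * pi}" if "u \<in> {0..<0 + 2 * pi}" for u
    using that assms(2)[of 0] strict_mono_less[OF assms(1), of u "0 + 2 * pi"] strict_mono_less_eq[OF assms(1), of 0 u] by auto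
  have "\<phi> s = \<phi> t"
    using inj_onD[OF inj_on_cis _ mem[OF s(1)] mem[OF t(1)]] xy(3) s t assms(3) by simp
  then show "x = y" using s t strict_mono_eq[OF assms(1)] by simp
qed

theorem theorem4p2:
  fixes G :: "complex set set" and c :: "'n::finite \<Rightarrow> complex set"
  assumes "gauss_diagram G" and "realizable G"
    and "bij_betw c UNIV G"
    and "\<And>i. \<exists>j. j \<noteq> i \<and> chords_cross (c i) (c j)"
  shows "(\<forall>i. bit_dot (row i (gauss_matrix c)) (row i (gauss_matrix c)) = 0) \<and>
    (\<forall>i j. \<not> chords_cross (c i) (c j) \<longrightarrow>
       bit_dot (row i (gauss_matrix c)) (row j (gauss_matrix c)) = 0) \<and>
    (\<forall>i j k. chords_cross (c i) (c j) \<and> chords_cross (c i) (c k) \<and> chords_cross (c j) (c k) \<longrightarrow>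
       bit_dot (row i (gauss_matrix c)) (row j (gauss_matrix c)) +
       bit_dot (row i (gauss_matrix c)) (row k (gauss_matrix c)) +
       bit_dot (row j (gauss_matrix c)) (row k (gauss_matrix c)) = 1)"
proof -
  obtain f h where f: "generic_immersion f" and "circle_op_homeo h" and G: "G = (\<lambda>c. h ` c) ` gauss_diagram_of f"
    using assms(2) unfolding realizable_def by blast
  then obtain \<phi> where \<phi>: "strict_mono \<phi>" "\<And>t. \<phi> (t + 2 * pi) = \<phi> t + 2 * pi" "\<And>t. h (cis t) = cis (\<phi> t)"
    unfolding circle_op_homeo_def by blast
  define g where "g x = complex_of_vec (f x)" for x
  define D where "D t = complex_of_vec (velocity f t)" for t
  define chords where "chords = {{x, y} | x y. x \<in> sphere 0 1 \<and> y \<in> sphere 0 1 \<and> x \<noteq> y \<and> g x = g y}"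
  have chords: "gauss_diagram_of f = chords"
    by (simp add: chords_def gauss_diagram_of_def g_def)
  have inj_h: "inj_on ((`) h) chords"
    by (rule inj_on_subset[OF inj_on_image_Pow[OF circle_op_homeo_inj_on[OF \<phi>]]]) (auto simp: chords_def)
  have bij_h: "bij_betw ((`) h) chords G"
    using inj_h G chords by (simp add: bij_betw_def)
  \<comment> \<open>Injectivity of \<open>h\<close> on the chords carries finiteness from
    \<open>G\<close> back to the immersion, which bounds its double points.\<close>
  have fin_chords: "finite chords"
    using bij_betw_finite[OF bij_h] assms(1) by (simp add: gauss_diagram_def)
  interpret plane_curve g D
  proof
    fix t
    have "smooth_curve (\<lambda>t. f (cis t))" using f by (simp add: generic_immersion_def circle_immersion_def)
    then have "((\<lambda>h s. vector_derivative h (at s)) ^^ 0) (\<lambda>t. f (cis t)) differentiable (at t)"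
      unfolding smooth_curve_def by blast
    then have "((\<lambda>t. f (cis t)) has_vector_derivative velocity f t) (at t)"
      by (simp add: velocity_def vector_derivative_works)
    then show "((\<lambda>t. g (cis t)) has_vector_derivative D t) (at t)"
      unfolding g_def D_def by (rule bounded_linear.has_vector_derivative[OF bounded_linear_complex_of_vec])
  next
    fix r s t assume "g (cis r) = g (cis s)" "g (cis s) = g (cis t)"
    moreover have "cis r \<in> sphere 0 1" "cis s \<in> sphere 0 1" "cis t \<in> sphere 0 1" by auto
    ultimately show "cis r = cis s \<or> cis s = cis t \<or> cis r = cis t"
      using f unfolding generic_immersion_def g_def complex_of_vec_eq_iff by blast
  next
    fix s t assume "cis s \<noteq> cis t" "g (cis s) = g (cis t)"
    then show "Im (D s * cnj (D t)) \<noteq> 0"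
      using f unfolding D_def by (intro complex_of_vec_spanning) (auto simp: generic_immersion_def g_def)
  next
    have "{cis t | t. \<exists>s. cis s \<noteq> cis t \<and> g (cis s) = g (cis t)} \<subseteq> \<Union> chords"
    proof clarify
      fix s t assume "cis s \<noteq> cis t" "g (cis s) = g (cis t)"
      then have "{cis s, cis t} \<in> chords" unfolding chords_def by fastforce
      then show "cis t \<in> \<Union> chords" by blast
    qed
    moreover have "finite (\<Union> chords)"
      using fin_chords by (rule finite_Union) (auto simp: chords_def)
    ultimately show "finite {cis t | t. \<exists>s. cis s \<noteq> cis t \<and> g (cis s) = g (cis t)}"
      by (rule finite_subset)
  qed
  define d where "d = inv_into chords ((`) h) \<circ> c"
  have bij_d: "bij_betw d UNIV chords"
    unfolding d_def by (rule bij_betw_trans[OF assms(3) bij_betw_inv_into[OF bij_h]])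
  have c_eq: "c i = h ` d i" for i
    using bij_betw_inv_into_right[OF bij_h] bij_betwE[OF assms(3)] by (simp add: d_def)
  interpret labelled_diagram g D d "\<lambda>i j. chords_cross (c i) (c j)"
  proof
    show "bij_betw d UNIV {{x, y} | x y. x \<in> sphere 0 1 \<and> y \<in> sphere 0 1 \<and> x \<noteq> y \<and> g x = g y}"
      using bij_d by (simp add: chords_def)
  next
    fix i j :: 'n assume "i \<noteq> j"
    then have "c i \<noteq> c j" using bij_betw_imp_inj_on[OF assms(3)] by (simp add: inj_eq)
    then have "disjnt (c i) (c j)"
      using assms(1) bij_betwE[OF assms(3)] by (auto simp: gauss_diagram_def pairwise_def)
    then show "d i \<inter> d j = {}" unfolding c_eq by (auto simp: disjnt_iff)
  next
    fix i j w s1 t1 s2 t2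
    assume *: "w \<le> s1" "s1 < t1" "t1 < w + 2 * pi" "w \<le> s2" "s2 < t2" "t2 < w + 2 * pi"
      "d i = {cis s1, cis t1}" "d j = {cis s2, cis t2}"
    \<comment> \<open>The lift is increasing and maps the window at \<open>w\<close> into the window
      at \<open>\<phi> w\<close>, so the order of the endpoints is preserved.\<close>
    have "chords_cross {cis (\<phi> s1), cis (\<phi> t1)} {cis (\<phi> s2), cis (\<phi> t2)} \<longleftrightarrow>
      \<phi> s1 < \<phi> s2 \<and> \<phi> s2 < \<phi> t1 \<and> \<phi> t1 < \<phi> t2 \<or> \<phi> s2 < \<phi> s1 \<and> \<phi> s1 < \<phi> t2 \<and> \<phi> t2 < \<phi> t1"
      by (rule chords_cross_window[of "\<phi> w"])
        (use * strict_mono_less[OF \<phi>(1)] strict_mono_less_eq[OF \<phi>(1)] in \<open>simp_all flip: \<phi>(2)\<close>)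
    then show "chords_cross (c i) (c j) \<longleftrightarrow> s1 < s2 \<and> s2 < t1 \<and> t1 < t2 \<or> s2 < s1 \<and> s1 < t2 \<and> t2 < t1"
      using * by (simp add: c_eq \<phi>(3) strict_mono_less[OF \<phi>(1)])
  qed
  have dot: "bit_dot (row i (gauss_matrix c)) (row j (gauss_matrix c))
      = (\<Sum>k\<in>UNIV. of_bool (chords_cross (c i) (c k) \<and> chords_cross (c j) (c k)))" for i j
    unfolding bit_dot_def using cr_irrefl
    by (intro sum.cong) (auto simp: row_def gauss_matrix_def)
  have part2: "bit_dot (row i (gauss_matrix c)) (row j (gauss_matrix c)) = 0"
    if "\<not> chords_cross (c i) (c j)" for i j
    unfolding dot by (rule sum_of_bool_bit_eq_0[OF even_cr_cr[OF that]])
  show ?thesis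
    using part2 cr_irrefl triple unfolding dot by blast
qed

end
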